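(* Consider the causal adversarial multi-path network model with passive feedback described in the context, with $C$ unit-capacity links and overwrite jamming, where both reliability and perfect secrecy are required. For any $\vec z=(z_{rw},z_{ro},z_{wo})$ with $z_{rw}+z_{ro}+z_{wo}\le C$, the capacity for simultaneous reliability and secrecy is $$R=\max\{0,\ C-z_{ro}-z_{wo}-z_{rw}\}.$$
   Context: Model. A sender (Alice) communicates with a receiver (Bob) over $C$ parallel directed noiseless links $L_1,\dots,L_C$, each of unit capacity (large-alphabet regime). A code of block length $n$ and rate $R$ has message $M$ uniform on $\{0,1\}^{nR}$ and uses private randomness of Alice unknown to the adversary. Passive feedback: the code may operate in $r\ge1$ rounds of lengths summing to $n$; in round $k$ Alice's codewords $\vec X^{(k)}_1,\dots,\vec X^{(k)}_C$ are functions of the message, her randomness, and all words received by Bob in earlier rounds (Alice observes everything Bob receives, causally). Bob decodes $\hat M$ from all received words. Adversary. Calvin, who knows the coding scheme, selects pairwise disjoint link sets $Z_{rw},Z_{ro},Z_{wo}$ (unknown to Alice and Bob) with $|Z_{rw}|\le z_{rw}$, $|Z_{ro}|\le z_{ro}$, $|Z_{wo}|\le z_{wo}$; he reads the links in $Z_r=Z_{rw}\cup Z_{ro}$ and jams the links in $Z_w=Z_{rw}\cup Z_{wo}$. He is causal: his jamming at time $t$ may depend only on symbols observed on $Z_r$ up to time $t$. Under overwrite jamming $\vec Y_i=\vec E_i$ for $i\in Z_w$ (Calvin replaces the symbols with his own choice) and $\vec Y_i=\vec X_i$ otherwise. Reliability and secrecy. Rate $R$ is achievable if for every $\varepsilon>0$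 and all sufficiently large $n$ there is such a code with $\Pr[\hat M\ne M]<\varepsilon$ against every admissible causal adversary and such that the message is perfectly secret from Calvin, i.e. the mutual information between $M$ and everything Calvin observes on the links of $Z_r$ (over all rounds) is zero. The capacity is the supremum of achievable rates. *)

theory Defs
  imports "HOL-Probability.Probability_Mass_Function"
begin

text \<open>
Signals: a function time => link => symbol.  Symbols are natural numbers; a code
over an alphabet of size q uses the symbols {0..<q}.  Links are 0..<C, time
steps are 0..<n.  Entries outside this range are the fixed constant undefined.
\<close>

type_synonym signal = "nat \<Rightarrow> nat \<Rightarrow> nat"

definition agree_on :: "(nat \<times> nat) set \<Rightarrow> signal \<Rightarrow> signal \<Rightarrow> bool" where
  "agree_on S y y' \<longleftrightarrow> (\<forall>(t, j)\<in>S. y t j = y' t j)"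

text \<open>Encoder: enc m u y t i is the symbol Alice sends on link i at time t, given
message m, private randomness u and the words y received by Bob (passive feedback).
The round of time t is rd t (rd monotone); the encoder may only depend on received
symbols of strictly earlier rounds.\<close>

definition valid_code ::
  "nat \<Rightarrow> nat \<Rightarrow> nat \<Rightarrow> (nat \<Rightarrow> nat) \<Rightarrow> (nat \<Rightarrow> nat \<Rightarrow> signal \<Rightarrow> nat \<Rightarrow> nat \<Rightarrow> nat) \<Rightarrow> bool" where
  "valid_code C q n rd enc \<longleftrightarrow>
     mono rd \<and>
     (\<forall>m u y t i. t < n \<and> i < C \<longrightarrow> enc m u y t i < q) \<and>
     (\<forall>m u y y' t i. agree_on {(t', j). rd t' < rd t} y y' \<longrightarrow> enc m u y t i = enc m u y' t i)"

definition admissible ::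
  "nat \<Rightarrow> nat \<Rightarrow> nat \<Rightarrow> nat \<Rightarrow> nat \<Rightarrow> nat \<Rightarrow> nat set \<Rightarrow> nat set \<Rightarrow> nat set
   \<Rightarrow> (signal \<Rightarrow> nat \<Rightarrow> nat \<Rightarrow> nat) \<Rightarrow> bool" where
  "admissible C q n zrw zro zwo Zrw Zro Zwo adv \<longleftrightarrow>
     Zrw \<union> Zro \<union> Zwo \<subseteq> {..<C} \<and>
     Zrw \<inter> Zro = {} \<and> Zrw \<inter> Zwo = {} \<and> Zro \<inter> Zwo = {} \<and>
     card Zrw \<le> zrw \<and> card Zro \<le> zro \<and> card Zwo \<le> zwo \<and>
     (\<forall>x t i. t < n \<and> i \<in> Zrw \<union> Zwo \<longrightarrow> adv x t i < q) \<and>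
     (\<forall>x x' t i. agree_on {(t', j). t' \<le> t \<and> j \<in> Zrw \<union> Zro} x x' \<longrightarrow> adv x t i = adv x' t i)"

fun exec ::
  "nat \<Rightarrow> (nat \<Rightarrow> 'u \<Rightarrow> signal \<Rightarrow> nat \<Rightarrow> nat \<Rightarrow> nat) \<Rightarrow> nat set \<Rightarrow> (signal \<Rightarrow> nat \<Rightarrow> nat \<Rightarrow> nat)
   \<Rightarrow> nat \<Rightarrow> 'u \<Rightarrow> nat \<Rightarrow> signal \<times> signal" where
  "exec C enc Zw adv m u 0 = ((\<lambda>_ _. undefined), (\<lambda>_ _. undefined))"
| "exec C enc Zw adv m u (Suc t) =
     (let (x, y) = exec C enc Zw adv m u t;
          xt = (\<lambda>i. if i < C then enc m u y t i else undefined);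
          x' = x(t := xt);
          yt = (\<lambda>i. if i < C then (if i \<in> Zw then adv x' t i else xt i) else undefined)
      in (x', y(t := yt)))"

definition msg_rand :: "nat \<Rightarrow> 'u pmf \<Rightarrow> (nat \<times> 'u) pmf" where
  "msg_rand K pu = pair_pmf (pmf_of_set {..<K}) pu"

definition error_prob ::
  "nat \<Rightarrow> nat \<Rightarrow> nat \<Rightarrow> 'u pmf \<Rightarrow> (nat \<Rightarrow> 'u \<Rightarrow> signal \<Rightarrow> nat \<Rightarrow> nat \<Rightarrow> nat) \<Rightarrow> (signal \<Rightarrow> nat)
   \<Rightarrow> nat set \<Rightarrow> (signal \<Rightarrow> nat \<Rightarrow> nat \<Rightarrow> nat) \<Rightarrow> real" where
  "error_prob C n K pu enc dec Zw adv =
     measure_pmf.prob (msg_rand K pu)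
       {(m, u). dec (snd (exec C enc Zw adv m u n)) \<noteq> m}"

definition view ::
  "nat \<Rightarrow> nat \<Rightarrow> (nat \<Rightarrow> 'u \<Rightarrow> signal \<Rightarrow> nat \<Rightarrow> nat \<Rightarrow> nat) \<Rightarrow> nat set \<Rightarrow> nat set
   \<Rightarrow> (signal \<Rightarrow> nat \<Rightarrow> nat \<Rightarrow> nat) \<Rightarrow> nat \<Rightarrow> 'u \<Rightarrow> signal" where
  "view C n enc Zw Zr adv m u =
     (\<lambda>t j. if j \<in> Zr then fst (exec C enc Zw adv m u n) t j else undefined)"

text \<open>Perfect secrecy: I(M; view) = 0, i.e. M and Calvin's view are independent:
the joint law equals the product of its marginals.\<close>

definition perfectly_secret ::
  "nat \<Rightarrow> nat \<Rightarrow> nat \<Rightarrow> 'u pmf \<Rightarrow> (nat \<Rightarrow> 'u \<Rightarrow> signal \<Rightarrow> nat \<Rightarrow> nat \<Rightarrow> nat)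
   \<Rightarrow> nat set \<Rightarrow> nat set \<Rightarrow> (signal \<Rightarrow> nat \<Rightarrow> nat \<Rightarrow> nat) \<Rightarrow> bool" where
  "perfectly_secret C n K pu enc Zw Zr adv \<longleftrightarrow>
     (let J = map_pmf (\<lambda>(m, u). (m, view C n enc Zw Zr adv m u)) (msg_rand K pu)
      in J = pair_pmf (map_pmf fst J) (map_pmf snd J))"

text \<open>Achievability of rate R (rate measured in q-ary symbols per link use; number of
messages K = ceiling (q^(nR))).  Large-alphabet regime: the code may choose any
alphabet size q \<ge> 2.  Alice's private randomness is any discrete distribution on nat.\<close>

definition achievable :: "nat \<Rightarrow> nat \<Rightarrow> nat \<Rightarrow> nat \<Rightarrow> real \<Rightarrow> bool" where
  "achievable C zrw zro zwo R \<longleftrightarrow>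
     (\<forall>\<epsilon>>0. \<exists>N. \<forall>n\<ge>N. \<exists>q K rd (pu :: nat pmf) enc dec.
        q \<ge> 2 \<and> K = nat \<lceil>real q powr (real n * R)\<rceil> \<and> valid_code C q n rd enc \<and>
        (\<forall>Zrw Zro Zwo adv. admissible C q n zrw zro zwo Zrw Zro Zwo adv \<longrightarrow>
           error_prob C n K pu enc dec (Zrw \<union> Zwo) adv < \<epsilon> \<and>
           perfectly_secret C n K pu enc (Zrw \<union> Zwo) (Zrw \<union> Zro) adv))"

definition capacity :: "nat \<Rightarrow> nat \<Rightarrow> nat \<Rightarrow> nat \<Rightarrow> real" where
  "capacity C zrw zro zwo = Sup {R. achievable C zrw zro zwo R}"

end

theory Submission
  imports Defs "HOL-Computational_Algebra.Polynomial" "HOL-Computational_Algebra.Primes"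
begin

text \<open>
  Write \<open>z = zrw + zro + zwo\<close> and \<open>D = C - z\<close>.

  Converse: if Calvin overwrites his writable links with zeros, then, given his view, Bob's
  observation has at most \<open>q ^ (n * D)\<close> values, whereas the message is independent of the view.

  Achievability: let \<open>q = p\<close> be a large prime and let every time step be a round. Steps 0 and 1 carry
  uniform symbols, whose sums over all links, as received by Bob, are a MAC key \<open>(a, b)\<close> that Alice
  knows by feedback and that is masked by a link Calvin does not control. At a data step, if \<open>l\<close>
  links have been seen jammed so far, the other \<open>D + (z - l)\<close> links carry the values of a polynomial
  with \<open>D\<close> message coefficients and \<open>z - l\<close> random ones. Jammed links are among Calvin's \<open>z\<close> links, so
  at most \<open>z - l\<close> of the values are his and they are uniform. If a new link is jammed, the same
  message block is sent again at the next step; this happens at most \<open>z\<close> times. The last two steps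
  carry the record \<open>w\<close> of all jamming events and its tag \<open>a * w + b\<close> on every link. Unless Calvin
  forges a tag, which has probability at most \<open>C / p\<close>, Bob learns which symbols are genuine and
  interpolates.
\<close>

subsection \<open>Executions\<close>

lemma exec_fst_nth:
  "t < n \<Longrightarrow> fst (exec C enc Zw adv m u n) t =
     (\<lambda>i. if i < C then enc m u (snd (exec C enc Zw adv m u t)) t i else undefined)"
  by (induction n) (auto simp: less_Suc_eq Let_def split: prod.splits)

lemma exec_snd_nth:
  "t < n \<Longrightarrow> snd (exec C enc Zw adv m u n) t =
     (\<lambda>i. if i < C then (if i \<in> Zw then adv (fst (exec C enc Zw adv m u (Suc t))) t i
                        else fst (exec C enc Zw adv m u n) t i) else undefined)"
  by (induction n) (auto simp: less_Suc_eq Let_def split: prod.splits)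

lemma exec_beyond:
  "n \<le> t \<Longrightarrow> fst (exec C enc Zw adv m u n) t = (\<lambda>_. undefined)"
  "n \<le> t \<Longrightarrow> snd (exec C enc Zw adv m u n) t = (\<lambda>_. undefined)"
  by (induction n) (auto simp: Let_def split: prod.splits)

lemma exec_snd_stable:
  "s < t \<Longrightarrow> t \<le> n \<Longrightarrow> snd (exec C enc Zw adv m u t) s = snd (exec C enc Zw adv m u n) s"
  by (simp only: exec_snd_nth exec_fst_nth order.strict_trans2)

text \<open>Lets the scheme draw its randomness from functions: \<open>achievable\<close> asks for a
  distribution on \<open>nat\<close>, and a numbering \<open>g\<close> translates.\<close>

lemma exec_reindex:
  "exec C (\<lambda>m u. enc m (g u)) Zw adv m u n = exec C enc Zw adv m (g u) n"
  by (induction n) (simp_all add: Let_def)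

subsection \<open>Arithmetic modulo a prime\<close>

text \<open>The root count is done over the integers instead of the residue field. Division by
  \<open>x - a\<close> leaves a remainder divisible by \<open>p\<close>, and primality cancels
  \<open>b - a\<close> at each other root \<open>b\<close>, so the quotient inherits these
  roots.\<close>

lemma const_poly_dvd_of_roots_mod_prime:
  fixes f :: "int poly" and p :: int
  assumes "prime p" "finite A" "\<And>a. a \<in> A \<Longrightarrow> p dvd poly f a"
    and "\<And>a b. a \<in> A \<Longrightarrow> b \<in> A \<Longrightarrow> a \<noteq> b \<Longrightarrow> \<not> p dvd a - b"
    and "degree f < card A"
  shows "[:p:] dvd f"
  using assms(2-)
proof (induction A arbitrary: f rule: finite_induct)
  case empty
  then show ?case by simp
next
  case (insert a A)
  define q where "q = synthetic_div f a"
  have f: "f = [:- a, 1:] * q + [:poly f a:]"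
    using synthetic_div_correct'[of a f] unfolding q_def by simp
  have "[:p:] dvd q"
  \<comment> \<open>With no further roots the induction hypothesis would ask for
    \<open>degree q < 0\<close>; in this case \<open>f\<close> is constant and
    \<open>q = 0\<close>.\<close>
  proof (cases "A = {}")
    case True
    with insert.prems(3) have "degree f = 0" by simp
    then have "q = 0" unfolding q_def by (simp add: synthetic_div_eq_0_iff)
    then show ?thesis by simp
  next
    case False
    show ?thesis
    proof (rule insert.IH)
      fix b assume b: "b \<in> A"
      have "poly f b - poly f a = (b - a) * poly q b"
        by (subst f) (simp add: algebra_simps)
      then have "p dvd (b - a) * poly q b"
        using insert.prems(1)[of a] insert.prems(1)[of b] b by (metis dvd_diff insertI1 insertI2)
      moreover have "\<not> p dvd b - a"
        using insert.prems(2)[of b a] insert.hyps(2) b by blast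
      ultimately show "p dvd poly q b"
        using \<open>prime p\<close> by (simp add: prime_dvd_mult_iff)
    next
      show "degree q < card A"
      proof -
        have "card A > 0" using insert.hyps False by (simp add: card_gt_0_iff)
        then show ?thesis
          using insert.prems(3) insert.hyps unfolding q_def by (simp add: degree_synthetic_div)
      qed
    qed (use insert.prems(2) in blast)
  qed
  moreover have "[:p:] dvd [:poly f a:]"
    using insert.prems(1)[of a] by simp
  ultimately show ?case
    by (subst f) (rule dvd_add, simp_all only: dvd_mult)
qed

text \<open>The points \<open>Suc i\<close> differ by less than \<open>p\<close>, so they are
  pairwise incongruent. The shift by one keeps link 0 away from the point 0, on which
  \<open>shares_inj_rand\<close> relies.\<close>

lemma power_sum_roots_mod_prime:
  fixes d :: "nat \<Rightarrow> int" and p :: nat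
  assumes "prime p" "S \<subseteq> {..<p}" "N \<le> card S"
    and "\<And>i. i \<in> S \<Longrightarrow> int p dvd (\<Sum>k<N. d k * int (Suc i) ^ k)"
    and "k < N"
  shows "int p dvd d k"
proof -
  define f where "f = (\<Sum>k<N. monom (d k) k)"
  have coeff: "coeff f j = (if j < N then d j else 0)" for j
    unfolding f_def by (simp add: coeff_sum if_distrib cong: if_cong)
  have "finite S" using assms(2) finite_subset by blast
  define A where "A = (\<lambda>i. int (Suc i)) ` S"
  have cardA: "card A = card S" unfolding A_def by (rule card_image) (auto simp: inj_on_def)
  have "[:int p:] dvd f"
  proof (rule const_poly_dvd_of_roots_mod_prime)
    show "prime (int p)" using assms(1) by simp
    show "finite A" unfolding A_def using \<open>finite S\<close> by simp
    show "degree f < card A"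
    proof -
      have "degree f < N" using coeff \<open>k < N\<close> by (intro degree_lessI) auto
      then show ?thesis using cardA assms(3) by simp
    qed
    show "int p dvd poly f a" if "a \<in> A" for a
      using that assms(4) unfolding A_def f_def by (auto simp: poly_sum poly_monom)
    show "\<not> int p dvd a - b" if ab: "a \<in> A" "b \<in> A" "a \<noteq> b" for a b
    proof
      assume dvd: "int p dvd a - b"
      obtain i j where ij: "a = int (Suc i)" "b = int (Suc j)" "i \<in> S" "j \<in> S"
        using ab unfolding A_def by auto
      have "i < p" "j < p" using ij assms(2) by auto
      then have "\<bar>a - b\<bar> < int p" using ij by simp
      moreover have "a - b \<noteq> 0" using ab by simp
      ultimately show False using dvd dvd_imp_le_int[of "a - b" "int p"] by simp
    qed
  qed
  then have "int p dvd coeff f k" using const_poly_dvd_iff by blast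
  then show ?thesis using coeff \<open>k < N\<close> by simp
qed

lemma sum_lessThan_add:
  fixes g :: "nat \<Rightarrow> 'a :: comm_monoid_add"
  shows "(\<Sum>k<a + b. g k) = (\<Sum>k<a. g k) + (\<Sum>k<b. g (a + k))"
  by (induction b) (simp_all add: add.assoc)

lemma eq_if_mod_diff_dvd:
  fixes a b p :: nat
  assumes "a < p" "b < p" "int p dvd int a - int b"
  shows "a = b"
proof (rule ccontr)
  assume "a \<noteq> b"
  then have "int a - int b \<noteq> 0" by simp
  with assms(3) have "\<bar>int p\<bar> \<le> \<bar>int a - int b\<bar>" by (rule dvd_imp_le_int[rotated])
  with assms(1,2) show False by linarith
qed

lemma eq_if_digits_eq:
  fixes m m' p :: nat
  assumes "m < p ^ N" "m' < p ^ N"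
    and "\<And>j. j < N \<Longrightarrow> m div p ^ j mod p = m' div p ^ j mod p"
  shows "m = m'"
proof -
  have "m mod p ^ j = m' mod p ^ j" if "j \<le> N" for j
    using that
  proof (induction j)
    case (Suc j)
    then show ?case using assms(3)[of j] by (simp add: mod_mult2_eq mult.commute[of p])
  qed simp
  from this[of N] show ?thesis using assms by simp
qed

text \<open>Finds the step that carries message block \<open>c\<close>: the one with exactly
  \<open>c\<close> intact predecessors.\<close>

lemma ex_rank:
  fixes S :: "nat set"
  assumes "finite S" "c < card S"
  shows "\<exists>t\<in>S. card {s \<in> S. s < t} = c"
  using assms
proof (induction S arbitrary: c rule: finite_linorder_max_induct)
  case (insert b A)
  have b: "b \<notin> A" using insert.hyps by blast
  show ?case
  proof (cases "c < card A")
    case True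
    then obtain t where t: "t \<in> A" "card {s \<in> A. s < t} = c" using insert.IH by blast
    have "{s \<in> insert b A. s < t} = {s \<in> A. s < t}" using insert.hyps t by fastforce
    with t show ?thesis by (intro bexI[of _ t]) auto
  next
    case False
    then have "c = card A" using insert.prems insert.hyps b by simp
    moreover have "{s \<in> insert b A. s < b} = A" using insert.hyps by auto
    ultimately show ?thesis by auto
  qed
qed simp

subsection \<open>Perfect secrecy and the converse\<close>

lemma perfectly_secretI:
  assumes "K > 0"
    and "\<And>m. m < K \<Longrightarrow> map_pmf (view C n enc Zw Zr adv m) pu = L"
  shows "perfectly_secret C n K pu enc Zw Zr adv"
proof -
  have "map_pmf (\<lambda>(m, u). (m, view C n enc Zw Zr adv m u)) (msg_rand K pu) =
      bind_pmf (pmf_of_set {..<K}) (\<lambda>m. map_pmf (Pair m) (map_pmf (view C n enc Zw Zr adv m) pu))"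
    unfolding msg_rand_def pair_pmf_def
    by (simp add: map_bind_pmf map_pmf_def bind_assoc_pmf bind_return_pmf)
  also have "\<dots> = bind_pmf (pmf_of_set {..<K}) (\<lambda>m. map_pmf (Pair m) L)"
    using assms by (intro bind_pmf_cong) (auto simp: set_pmf_of_set lessThan_empty_iff)
  also have "\<dots> = pair_pmf (pmf_of_set {..<K}) L"
    by (simp add: pair_pmf_def map_pmf_def)
  finally show ?thesis
    unfolding perfectly_secret_def by (simp add: map_fst_pair_pmf map_snd_pair_pmf)
qed

section \<open>Guessing the message from a perfectly secret view\<close>

lemma prob_bind_pmf_le:
  assumes "\<And>x. x \<in> set_pmf M \<Longrightarrow> measure_pmf.prob (N x) X \<le> c"
  shows "measure_pmf.prob (bind_pmf M N) X \<le> c"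
proof -
  obtain x where "x \<in> set_pmf M" using set_pmf_not_empty by fast
  with assms have "c \<ge> 0" by (meson measure_nonneg order_trans)
  have "emeasure (measure_pmf (bind_pmf M N)) X = (\<integral>\<^sup>+x. emeasure (N x) X \<partial>M)"
    by simp
  also have "\<dots> \<le> (\<integral>\<^sup>+x. ennreal c \<partial>M)"
    using assms by (intro nn_integral_mono_AE)
      (auto simp: AE_measure_pmf_iff measure_pmf.emeasure_eq_measure intro: ennreal_leI)
  finally show ?thesis
    using \<open>c \<ge> 0\<close> by (simp add: measure_pmf.emeasure_eq_measure)
qed

lemma prob_pair_pmf_uniform_le:
  assumes "K > 0" "\<And>v. finite (G v)" "\<And>v. card (G v) \<le> L"
  shows "measure_pmf.prob (pair_pmf (pmf_of_set {..<K::nat}) V) {(m, v). m \<in> G v} \<le> real L / real K"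
proof -
  have pair: "pair_pmf (pmf_of_set {..<K}) V =
      V \<bind> (\<lambda>v. map_pmf (\<lambda>m. (m, v)) (pmf_of_set {..<K}))"
    unfolding pair_pmf_def map_pmf_def by (rule bind_commute_pmf)
  show ?thesis
    unfolding pair
  proof (rule prob_bind_pmf_le)
    fix v
    have "measure_pmf.prob (map_pmf (\<lambda>m. (m, v)) (pmf_of_set {..<K})) {(m, v). m \<in> G v} =
          measure_pmf.prob (pmf_of_set {..<K}) (G v)"
      by (simp add: vimage_def)
    also have "\<dots> = real (card ({..<K} \<inter> G v)) / real K"
      using assms(1) by (subst measure_pmf_of_set) (auto simp: lessThan_empty_iff)
    also have "\<dots> \<le> real L / real K"
    proof -
      have "card ({..<K} \<inter> G v) \<le> card (G v)" using assms(2) by (intro card_mono) auto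
      also have "\<dots> \<le> L" by (rule assms(3))
      finally show ?thesis by (simp add: divide_right_mono)
    qed
    finally show "measure_pmf.prob (map_pmf (\<lambda>m. (m, v)) (pmf_of_set {..<K})) {(m, v). m \<in> G v}
        \<le> real L / real K" .
  qed
qed

text \<open>Secrecy makes the joint law a product, so the view can be fixed first; the message is
  still uniform and hits a list of \<open>L\<close> guesses with probability at most
  \<open>L / K\<close>.\<close>

lemma prob_le_if_perfectly_secret:
  assumes "perfectly_secret C n K pu enc Zw Zr adv" "K > 0"
    and "\<And>v. finite (G v)" "\<And>v. card (G v) \<le> L"
  shows "measure_pmf.prob (msg_rand K pu) {(m, u). m \<in> G (view C n enc Zw Zr adv m u)}
           \<le> real L / real K"
proof -
  define J where "J = map_pmf (\<lambda>(m, u). (m, view C n enc Zw Zr adv m u)) (msg_rand K pu)"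
  have "map_pmf fst J = map_pmf fst (msg_rand K pu)"
    unfolding J_def by (simp add: pmf.map_comp o_def case_prod_unfold)
  then have "map_pmf fst J = pmf_of_set {..<K}"
    unfolding msg_rand_def by (simp add: map_fst_pair_pmf)
  then have J: "J = pair_pmf (pmf_of_set {..<K}) (map_pmf snd J)"
    using assms(1) unfolding perfectly_secret_def J_def[symmetric] by (simp add: Let_def)
  have "measure_pmf.prob (msg_rand K pu) {(m, u). m \<in> G (view C n enc Zw Zr adv m u)} =
        measure_pmf.prob J {(m, v). m \<in> G v}"
    unfolding J_def by (simp add: vimage_def case_prod_unfold)
  also have "\<dots> \<le> real L / real K"
    by (subst J) (rule prob_pair_pmf_uniform_le[OF assms(2-)])
  finally show ?thesis .
qed

text \<open>Given the view, Bob's word depends only on the symbols of the links that Calvin neither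
  reads nor writes. The decoder's outputs over all such symbols form a list, and correct decoding
  puts the message into it.\<close>

lemma error_prob_lower_bound:
  assumes z: "zrw + zro + zwo \<le> C" and "K > 0" "q \<ge> 2"
    and valid: "valid_code C q n rd enc"
    and all: "\<And>Zrw Zro Zwo adv. admissible C q n zrw zro zwo Zrw Zro Zwo adv \<Longrightarrow>
      error_prob C n K pu enc dec (Zrw \<union> Zwo) adv < \<epsilon> \<and>
      perfectly_secret C n K pu enc (Zrw \<union> Zwo) (Zrw \<union> Zro) adv"
  shows "1 - \<epsilon> < real q ^ (n * (C - (zrw + zro + zwo))) / real K"
proof -
  define z where "z = zrw + zro + zwo"
  define Zrw where "Zrw = {..<zrw}"
  define Zro where "Zro = {zrw..<zrw + zro}"
  define Zwo where "Zwo = {zrw + zro..<z}"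
  define adv :: "signal \<Rightarrow> nat \<Rightarrow> nat \<Rightarrow> nat" where "adv = (\<lambda>_ _ _. 0)"
  let ?Zw = "Zrw \<union> Zwo" and ?Zr = "Zrw \<union> Zro"
  have adm: "admissible C q n zrw zro zwo Zrw Zro Zwo adv"
    unfolding admissible_def Zrw_def Zro_def Zwo_def z_def adv_def using z \<open>q \<ge> 2\<close> by auto
  note err = all[OF adm, THEN conjunct1] and sec = all[OF adm, THEN conjunct2]
  define P where "P = PiE ({..<n} \<times> {z..<C}) (\<lambda>_. {..<q})"
  \<comment> \<open>On read-only links Bob receives what Calvin saw. The value
    \<open>undefined\<close> outside the range matches \<open>exec\<close>.\<close>
  define recv where "recv = (\<lambda>(v :: signal) (g :: nat \<times> nat \<Rightarrow> nat) t i.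
    if t < n \<and> i < C then (if i \<in> ?Zw then 0 else if i \<in> Zro then v t i else g (t, i)) else undefined)"
  define G where "G = (\<lambda>v. (\<lambda>g. dec (recv v g)) ` P)"
  have fin: "finite P" unfolding P_def by (intro finite_PiE) auto
  have cardP: "card P = q ^ (n * (C - z))"
    unfolding P_def by (simp add: card_PiE card_cartesian_product)
  have G: "finite (G v)" "card (G v) \<le> q ^ (n * (C - z))" for v
    unfolding G_def cardP[symmetric] using fin by (auto intro: card_image_le)
  have mem: "dec (snd (exec C enc ?Zw adv m u n)) \<in> G (view C n enc ?Zw ?Zr adv m u)" for m u
  proof -
    let ?x = "fst (exec C enc ?Zw adv m u n)"
    define g where "g = restrict (\<lambda>(t, i). ?x t i) ({..<n} \<times> {z..<C})"
    have lt: "?x t i < q" if "t < n" "i < C" for t i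
      using valid that by (simp add: exec_fst_nth valid_code_def)
    have "g \<in> P" unfolding g_def P_def using lt by (auto simp: PiE_iff extensional_def)
    moreover have "snd (exec C enc ?Zw adv m u n) = recv (view C n enc ?Zw ?Zr adv m u) g"
    proof (intro ext)
      fix t i
      show "snd (exec C enc ?Zw adv m u n) t i = recv (view C n enc ?Zw ?Zr adv m u) g t i"
      proof (cases "t < n \<and> i < C")
        case True
        then show ?thesis
          by (auto simp: exec_snd_nth recv_def adv_def view_def g_def Zrw_def Zro_def Zwo_def z_def)
      next
        case False
        then show ?thesis by (cases "t < n") (auto simp: exec_snd_nth recv_def exec_beyond)
      qed
    qed
    ultimately show ?thesis unfolding G_def by (simp add: image_eqI)
  qed
  have "1 - \<epsilon> < 1 - error_prob C n K pu enc dec ?Zw adv" using err by simp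
  also have "\<dots> = measure_pmf.prob (msg_rand K pu) {(m, u). dec (snd (exec C enc ?Zw adv m u n)) = m}"
    unfolding error_prob_def
    by (subst measure_pmf.prob_compl[symmetric, simplified])
       (auto intro!: arg_cong[where f = "measure_pmf.prob _"])
  also have "\<dots> \<le> measure_pmf.prob (msg_rand K pu) {(m, u). m \<in> G (view C n enc ?Zw ?Zr adv m u)}"
  proof (intro measure_pmf.finite_measure_mono subsetI)
    fix mu assume "mu \<in> {(m, u). dec (snd (exec C enc ?Zw adv m u n)) = m}"
    then show "mu \<in> {(m, u). m \<in> G (view C n enc ?Zw ?Zr adv m u)}"
      using mem[of "fst mu" "snd mu"] by (auto simp: case_prod_unfold)
  qed simp
  also have "\<dots> \<le> real (q ^ (n * (C - z))) / real K"
    by (rule prob_le_if_perfectly_secret[OF sec \<open>K > 0\<close> G])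
  finally show ?thesis by (simp add: z_def)
qed

theorem achievable_upper_bound:
  assumes z: "zrw + zro + zwo \<le> C" and ach: "achievable C zrw zro zwo R"
  shows "R \<le> real (C - (zrw + zro + zwo))"
proof (rule ccontr)
  define D where "D = C - (zrw + zro + zwo)"
  assume "\<not> R \<le> real (C - (zrw + zro + zwo))"
  then have gap: "R - real D > 0" by (simp add: D_def)
  obtain N where N: "\<forall>n\<ge>N. \<exists>q K rd (pu :: nat pmf) enc dec.
        q \<ge> 2 \<and> K = nat \<lceil>real q powr (real n * R)\<rceil> \<and> valid_code C q n rd enc \<and>
        (\<forall>Zrw Zro Zwo adv. admissible C q n zrw zro zwo Zrw Zro Zwo adv \<longrightarrow>
           error_prob C n K pu enc dec (Zrw \<union> Zwo) adv < 1 / 2 \<and>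
           perfectly_secret C n K pu enc (Zrw \<union> Zwo) (Zrw \<union> Zro) adv)"
    using ach unfolding achievable_def by (meson half_gt_zero zero_less_one)
  \<comment> \<open>Once \<open>n * (R - D)\<close> is at least 1, the bound
    \<open>q ^ (n * D) / K\<close> is at most \<open>1 / q\<close>, hence at most
    \<open>1 / 2\<close> whatever alphabet the code takes; this contradicts an error below
    \<open>1 / 2\<close>.\<close>
  obtain n0 :: nat where n0: "1 / (R - real D) < real n0" using reals_Archimedean2 by blast
  define n where "n = max N n0"
  have n: "1 \<le> real n * (R - real D)"
  proof -
    have "1 / (R - real D) \<le> real n" using n0 by (simp add: n_def)
    then show ?thesis using gap by (simp add: field_simps)
  qed
  have "n \<ge> N" by (simp add: n_def)
  then obtain q K rd enc dec and pu :: "nat pmf" where code: "q \<ge> 2"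
      "K = nat \<lceil>real q powr (real n * R)\<rceil>" "valid_code C q n rd enc"
      "\<And>Zrw Zro Zwo adv. admissible C q n zrw zro zwo Zrw Zro Zwo adv \<Longrightarrow>
           error_prob C n K pu enc dec (Zrw \<union> Zwo) adv < 1 / 2 \<and>
           perfectly_secret C n K pu enc (Zrw \<union> Zwo) (Zrw \<union> Zro) adv"
    using N by metis
  have q: "real q > 0" using code(1) by simp
  then have pos: "real q powr (real n * R) > 0" by simp
  have K: "real K \<ge> real q powr (real n * R)" unfolding code(2) by linarith
  with pos have "K > 0" by (simp add: code(2))
  have "1 - 1 / 2 < real q ^ (n * D) / real K"
    unfolding D_def by (rule error_prob_lower_bound[OF z \<open>K > 0\<close> code(1,3,4)])
  also have "\<dots> \<le> real q ^ (n * D) / real q powr (real n * R)"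
    using K pos \<open>K > 0\<close> by (intro divide_left_mono) auto
  also have "\<dots> = real q powr (- (real n * (R - real D)))"
    using q by (simp add: powr_realpow[symmetric] powr_diff[symmetric] algebra_simps)
  also have "\<dots> \<le> real q powr (- 1)"
    using n code(1) by (intro powr_mono) auto
  also have "\<dots> \<le> 1 / 2"
    using code(1) by (simp add: powr_minus field_simps)
  finally show False by simp
qed

subsection \<open>The coding scheme\<close>

text \<open>The map \<open>h\<close> compresses a whole jamming record into one symbol, so that
  record and tag take one step each; a large alphabet makes room for this. The bound on
  \<open>n\<close> leaves space for two key steps and two closing steps.\<close>

locale scheme =
  fixes D z n p :: nat and h :: "(nat \<Rightarrow> nat) \<Rightarrow> nat"
  assumes prime: "prime p" and D_pos: "D > 0" and links_less: "D + z < p" and n_ge: "n \<ge> 4"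
    and h_less: "\<And>A. h A < p" and inj_h: "inj_on h (PiE {..<D + z} (\<lambda>_. {..n}))"
begin

abbreviation C :: nat where "C \<equiv> D + z"

lemma p_pos: "p > 0" using prime by (simp add: prime_gt_0_nat)

definition digit :: "nat \<Rightarrow> nat \<Rightarrow> nat" where
  "digit m j = m div p ^ j mod p"

text \<open>A jamming record \<open>A\<close> maps every link to the first data step at which it was jammed, and to
  \<open>n\<close> if there is none.\<close>

definition jammed :: "(nat \<Rightarrow> nat) \<Rightarrow> nat \<Rightarrow> nat set" where
  "jammed A t = {i. i < C \<and> A i < t}"

text \<open>These are the steps without a new jamming, whose block counts as delivered. Hence
  \<open>card (intact A t)\<close> is the index of the block to send at step \<open>t\<close>. The
  default value \<open>n\<close> of a record exceeds every step and excludes none.\<close>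

definition intact :: "(nat \<Rightarrow> nat) \<Rightarrow> nat \<Rightarrow> nat set" where
  "intact A t = {s. 2 \<le> s \<and> s < t \<and> s \<notin> A ` {..<C}}"

text \<open>With \<open>l\<close> jammed links there are as many coefficients as links in use,
  \<open>D + (z - l)\<close>, so these links together determine the polynomial, while the
  \<open>z - l\<close> random coefficients mask the message from any \<open>z - l\<close> of
  them.\<close>

definition share :: "nat \<Rightarrow> (nat \<times> nat \<Rightarrow> nat) \<Rightarrow> (nat \<Rightarrow> nat) \<Rightarrow> nat \<Rightarrow> nat \<Rightarrow> nat" where
  "share m r A t i = (if A i < t then 0 else
     ((\<Sum>k<D. digit m (card (intact A t) * D + k) * Suc i ^ k) +
      (\<Sum>k<z - card (jammed A t). r (t, k) * Suc i ^ (D + k))) mod p)"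

text \<open>Only visible deviations count: if Calvin writes the very symbol that Alice sent, the
  received symbol is genuine all the same.\<close>

primrec jamrec :: "nat \<Rightarrow> (nat \<times> nat \<Rightarrow> nat) \<Rightarrow> signal \<Rightarrow> nat \<Rightarrow> nat \<Rightarrow> nat" where
  "jamrec m u y 0 = restrict (\<lambda>_. n) {..<C}"
| "jamrec m u y (Suc t) = (\<lambda>i.
     if jamrec m u y t i = n \<and> 2 \<le> t \<and> t < n - 2 \<and> i < C \<and> y t i \<noteq> share m u (jamrec m u y t) t i
     then t else jamrec m u y t i)"

definition key :: "signal \<Rightarrow> nat \<Rightarrow> nat" where
  "key y t = (\<Sum>i<C. y t i)"

definition tag :: "signal \<Rightarrow> nat \<Rightarrow> nat" where
  "tag y w = (key y 0 * w + key y 1) mod p"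

text \<open>\<open>valid_code\<close> demands symbols below \<open>p\<close> for every value of the
  randomness, whence the reduction of \<open>u (t, i)\<close>.\<close>

definition encode :: "nat \<Rightarrow> (nat \<times> nat \<Rightarrow> nat) \<Rightarrow> signal \<Rightarrow> nat \<Rightarrow> nat \<Rightarrow> nat" where
  "encode m u y t i =
     (if t < 2 then u (t, i) mod p
      else if t < n - 2 then share m u (jamrec m u y t) t i
      else if t = n - 2 then h (jamrec m u y (n - 2))
      else tag y (h (jamrec m u y (n - 2))))"

text \<open>For the true record, the links with \<open>t < A i\<close> delivered genuine shares at
  step \<open>t\<close>. The coefficients \<open>r\<close> are bound existentially because Bob does
  not know them.\<close>

definition consistent :: "signal \<Rightarrow> (nat \<Rightarrow> nat) \<Rightarrow> nat \<Rightarrow> bool" where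
  "consistent y A m \<longleftrightarrow>
     (\<exists>r. \<forall>t\<in>intact A (n - 2). \<forall>i<C. t < A i \<longrightarrow> y t i = share m r A t i)"

definition accepted :: "signal \<Rightarrow> nat \<Rightarrow> bool" where
  "accepted y w \<longleftrightarrow> (\<exists>i<C. y (n - 2) i = w \<and> y (n - 1) i = tag y w)"

definition decode :: "nat \<Rightarrow> signal \<Rightarrow> nat" where
  "decode K y = (SOME m. m < K \<and>
     (\<exists>A \<in> PiE {..<C} (\<lambda>_. {..n}). accepted y (h A) \<and> consistent y A m))"

text \<open>Coordinate \<open>(t, k)\<close> is the symbol for link \<open>k\<close> at the key
  steps and the \<open>k\<close>-th random coefficient at the data steps.\<close>

definition rands :: "(nat \<times> nat \<Rightarrow> nat) set" where
  "rands = PiE ({..<n} \<times> {..<C}) (\<lambda>_. {..<p})"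

lemma finite_rands: "finite rands"
  unfolding rands_def by (intro finite_PiE) auto

lemma rands_nonempty: "rands \<noteq> {}"
  unfolding rands_def using p_pos by (auto simp: PiE_eq_empty_iff)

lemma rands_less: "u \<in> rands \<Longrightarrow> t < n \<Longrightarrow> k < C \<Longrightarrow> u (t, k) < p"
  unfolding rands_def by (auto simp: PiE_iff)

lemma rands_upd:
  assumes "u \<in> rands" "t < n" "k < C" "a < p"
  shows "u((t, k) := a) \<in> rands"
proof -
  have "u((t, k) := a) \<in> PiE (insert (t, k) ({..<n} \<times> {..<C})) (\<lambda>_. {..<p})"
    using assms unfolding rands_def by (intro PiE_fun_upd) auto
  moreover have "insert (t, k) ({..<n} \<times> {..<C}) = {..<n} \<times> {..<C}" using assms by auto
  ultimately show ?thesis unfolding rands_def by simp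
qed

lemma share_less: "share m r A t i < p"
  unfolding share_def using p_pos by simp

lemma encode_less: "encode m u y t i < p"
  unfolding encode_def tag_def using p_pos h_less share_less by auto

section \<open>Jamming records along a run\<close>

lemma jamrec_cong:
  assumes "\<And>s i. s < t \<Longrightarrow> y s i = y' s i"
  shows "jamrec m u y t = jamrec m u y' t"
  using assms by (induction t) (simp_all cong: if_cong)

lemma encode_causal:
  assumes "\<And>s i. s < t \<Longrightarrow> y s i = y' s i"
  shows "encode m u y t i = encode m u y' t i"
proof (cases "t < n - 2 \<or> t < 2")
  case True
  then show ?thesis using jamrec_cong[OF assms(1)] by (auto simp: encode_def)
next
  case False
  then have "jamrec m u y (n - 2) = jamrec m u y' (n - 2)"
    by (intro jamrec_cong assms(1)) auto
  moreover have "t \<noteq> n - 2 \<Longrightarrow> key y 0 = key y' 0 \<and> key y 1 = key y' 1"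
    unfolding key_def using assms False n_ge by auto
  ultimately show ?thesis using False by (auto simp: encode_def tag_def)
qed

lemma jamrec_PiE: "jamrec m u y t \<in> PiE {..<C} (\<lambda>_. {..n})"
  by (induction t) (auto simp: PiE_iff extensional_def)

lemma jamrec_less: "jamrec m u y t i = n \<or> i \<ge> C \<or> 2 \<le> jamrec m u y t i \<and> jamrec m u y t i < t"
  by (induction t) auto

text \<open>Each entry is changed at most once, and its new value is the time of the change.\<close>

lemma jamrec_truncate:
  assumes "s \<le> t" "t \<le> n" "i < C"
  shows "jamrec m u y s i = (if jamrec m u y t i < s then jamrec m u y t i else n)"
  using assms
proof (induction t)
  case (Suc t)
  show ?case
  proof (cases "s = Suc t")
    case True
    then show ?thesis using jamrec_less[of m u y "Suc t" i] Suc.prems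
      by (metis leD not_le_imp_less)
  next
    case False
    then show ?thesis using Suc.IH Suc.prems by (auto split: if_splits)
  qed
qed simp

text \<open>Bob gets only the final record, whereas Alice computed each share from the record of its
  time. A share at step \<open>s\<close> looks only at events before \<open>s\<close>, on which both
  records coincide.\<close>

lemma share_jamrec:
  assumes "s \<le> t" "t \<le> n" "i < C"
  shows "share m r (jamrec m' u y s) s i = share m r (jamrec m' u y t) s i"
proof -
  let ?A = "jamrec m' u y s" and ?B = "jamrec m' u y t"
  have iff: "?A j < s \<longleftrightarrow> ?B j < s" if "j < C" for j
    using jamrec_truncate[OF assms(1,2) that, of m' u y] assms by (auto split: if_splits)
  then have "jammed ?A s = jammed ?B s"
    unfolding jammed_def by auto
  moreover have "intact ?A s = intact ?B s"
  proof -
    have "v \<in> ?A ` {..<C} \<longleftrightarrow> v \<in> ?B ` {..<C}" if "v < s" for v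
      using jamrec_truncate[OF assms(1,2), of _ m' u y] assms that by (force simp: image_iff)
    then show ?thesis unfolding intact_def by auto
  qed
  moreover note iff[OF assms(3)]
  ultimately show ?thesis unfolding share_def by simp
qed

text \<open>A deviation at step \<open>t\<close> on a link not marked so far would have set its
  entry to \<open>t\<close>.\<close>

lemma jamrec_gtD:
  assumes "t < jamrec m u y (n - 2) i" "2 \<le> t" "t < n - 2" "i < C"
  shows "y t i = share m u (jamrec m u y t) t i"
proof (rule ccontr)
  assume ne: "y t i \<noteq> share m u (jamrec m u y t) t i"
  have "jamrec m u y t i = n"
    using jamrec_truncate[of t "n - 2" i m u y] assms by auto
  then have "jamrec m u y (Suc t) i = t" using ne assms by simp
  then have "jamrec m u y (n - 2) i = t"
    using jamrec_truncate[of "Suc t" "n - 2" i m u y] assms by (auto split: if_splits)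
  with assms show False by simp
qed

section \<open>Recovering coefficients from shares modulo \<open>p\<close>\<close>

lemma shares_dvd:
  assumes "share m r A t i = share m' r' A t i" "\<not> A i < t"
  shows "int p dvd
    (\<Sum>k<D. (int (digit m (card (intact A t) * D + k)) - int (digit m' (card (intact A t) * D + k)))
        * int (Suc i) ^ k) +
    (\<Sum>k<z - card (jammed A t). (int (r (t, k)) - int (r' (t, k))) * int (Suc i) ^ (D + k))"
proof -
  let ?f = "\<lambda>m r. (\<Sum>k<D. digit m (card (intact A t) * D + k) * Suc i ^ k) +
      (\<Sum>k<z - card (jammed A t). r (t, k) * Suc i ^ (D + k))"
  have "?f m r mod p = ?f m' r' mod p" using assms by (simp add: share_def)
  then have "int (?f m r) mod int p = int (?f m' r') mod int p"
    unfolding zmod_int[symmetric] by (rule arg_cong)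
  then have "int p dvd int (?f m r) - int (?f m' r')"
    unfolding mod_eq_dvd_iff .
  also have "int (?f m r) - int (?f m' r') =
    (\<Sum>k<D. (int (digit m (card (intact A t) * D + k)) - int (digit m' (card (intact A t) * D + k)))
        * int (Suc i) ^ k) +
    (\<Sum>k<z - card (jammed A t). (int (r (t, k)) - int (r' (t, k))) * int (Suc i) ^ (D + k))"
    by (simp add: sum_subtractf left_diff_distrib del: of_nat_Suc)
  finally show ?thesis .
qed

text \<open>With the same message on both sides the message part cancels. What remains is
  \<open>Suc i ^ D\<close>, a unit modulo \<open>p\<close>, times a polynomial with as many
  coefficients as \<open>S\<close> has points.\<close>

lemma shares_inj_rand:
  assumes S: "S \<subseteq> {..<C} - jammed A t" "card S = z - card (jammed A t)"
    and eq: "\<And>i. i \<in> S \<Longrightarrow> share m r A t i = share m r' A t i"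
    and k: "k < z - card (jammed A t)" and less: "r (t, k) < p" "r' (t, k) < p"
  shows "r (t, k) = r' (t, k)"
proof (rule eq_if_mod_diff_dvd[OF less])
  show "int p dvd int (r (t, k)) - int (r' (t, k))"
  proof (rule power_sum_roots_mod_prime[OF prime, where S = S and d = "\<lambda>k. int (r (t, k)) - int (r' (t, k))"])
    show "S \<subseteq> {..<p}" using S links_less by auto
    show "z - card (jammed A t) \<le> card S" using S by simp
    show "k < z - card (jammed A t)" by (rule k)
    fix i assume i: "i \<in> S"
    then have "\<not> A i < t" using S unfolding jammed_def by auto
    from shares_dvd[OF eq[OF i] this]
    have "int p dvd int (Suc i) ^ D *
        (\<Sum>k<z - card (jammed A t). (int (r (t, k)) - int (r' (t, k))) * int (Suc i) ^ k)"
      by (simp add: power_add sum_distrib_left mult.left_commute del: of_nat_Suc)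
    moreover have "\<not> int p dvd int (Suc i) ^ D"
    proof
      assume "int p dvd int (Suc i) ^ D"
      then have "p dvd Suc i ^ D" by (metis of_nat_dvd_iff of_nat_power)
      then have "p dvd Suc i" using prime prime_dvd_power by blast
      then have "p \<le> Suc i" by (simp add: dvd_imp_le)
      then show False using i S links_less by auto
    qed
    ultimately show "int p dvd (\<Sum>k<z - card (jammed A t). (int (r (t, k)) - int (r' (t, k))) * int (Suc i) ^ k)"
      using prime_dvd_mult_iff[of "int p"] prime by (metis prime_nat_int_transfer)
  qed
qed

text \<open>The links not yet jammed give as many evaluation points as there are coefficients,
  message digits and random ones together.\<close>

lemma shares_inj_digits:
  assumes card: "card (jammed A t) \<le> z"
    and eq: "\<And>i. i < C \<Longrightarrow> \<not> A i < t \<Longrightarrow> share m r A t i = share m' r' A t i"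
    and k: "k < D"
  shows "digit m (card (intact A t) * D + k) = digit m' (card (intact A t) * D + k)"
proof (rule eq_if_mod_diff_dvd[of _ p])
  show "digit m (card (intact A t) * D + k) < p" "digit m' (card (intact A t) * D + k) < p"
    using p_pos by (simp_all add: digit_def)
  let ?\<rho> = "z - card (jammed A t)"
  let ?d = "\<lambda>k. int (digit m (card (intact A t) * D + k)) - int (digit m' (card (intact A t) * D + k))"
  \<comment> \<open>The differences of all coefficients in one sequence, the digits first.\<close>
  define c where "c = (\<lambda>k. if k < D then ?d k else int (r (t, k - D)) - int (r' (t, k - D)))"
  have jam: "jammed A t \<subseteq> {..<C}" unfolding jammed_def by auto
  have "int p dvd c k"
  proof (rule power_sum_roots_mod_prime[OF prime, of "{..<C} - jammed A t" "D + ?\<rho>"])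
    show "{..<C} - jammed A t \<subseteq> {..<p}" using links_less by auto
    show "D + ?\<rho> \<le> card ({..<C} - jammed A t)"
      using jam card by (subst card_Diff_subset) (auto intro: finite_subset)
    show "k < D + ?\<rho>" using k by simp
    fix i assume "i \<in> {..<C} - jammed A t"
    then have i: "i < C" "\<not> A i < t" unfolding jammed_def by auto
    show "int p dvd (\<Sum>k<D + ?\<rho>. c k * int (Suc i) ^ k)"
      using shares_dvd[OF eq[OF i] i(2)] by (simp add: sum_lessThan_add c_def)
  qed
  then show "int p dvd ?d k" using k by (simp add: c_def)
qed

text \<open>Digit \<open>j\<close> of the message belongs to block \<open>j div D\<close>, which was
  sent at the intact step with exactly that many intact predecessors. The shares of that step
  determine the digit.\<close>

lemma consistent_unique:
  assumes "consistent y A m" "consistent y A m'"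
    and "\<And>t. t \<in> intact A (n - 2) \<Longrightarrow> card (jammed A t) \<le> z" and N: "N \<le> card (intact A (n - 2))"
    and "m < p ^ (D * N)" "m' < p ^ (D * N)"
  shows "m = m'"
proof -
  obtain r where r: "\<And>t i. t \<in> intact A (n - 2) \<Longrightarrow> i < C \<Longrightarrow> t < A i \<Longrightarrow> y t i = share m r A t i"
    using assms(1) unfolding consistent_def by blast
  obtain r' where r': "\<And>t i. t \<in> intact A (n - 2) \<Longrightarrow> i < C \<Longrightarrow> t < A i \<Longrightarrow> y t i = share m' r' A t i"
    using assms(2) unfolding consistent_def by blast
  show ?thesis
  proof (rule eq_if_digits_eq[OF assms(5,6)])
    fix j assume j: "j < D * N"
    define c where "c = j div D"
    have "c < N" using j D_pos unfolding c_def by (simp add: less_mult_imp_div_less mult.commute)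
    then have "c < card (intact A (n - 2))" using N by simp
    moreover have "finite (intact A (n - 2))" unfolding intact_def by auto
    ultimately obtain t where t: "t \<in> intact A (n - 2)" "card {s \<in> intact A (n - 2). s < t} = c"
      using ex_rank by blast
    have "{s \<in> intact A (n - 2). s < t} = intact A t"
      using t(1) unfolding intact_def by auto
    then have c: "card (intact A t) = c" using t by simp
    have "digit m (card (intact A t) * D + j mod D) = digit m' (card (intact A t) * D + j mod D)"
    proof (rule shares_inj_digits[OF assms(3)[OF t(1)]])
      show "j mod D < D" using D_pos by simp
      fix i assume i: "i < C" "\<not> A i < t"
      \<comment> \<open>At an intact step no link is newly jammed, so all links not jammed before it
        can be trusted.\<close>
      moreover have "A i \<noteq> t" using t(1) i unfolding intact_def by auto
      ultimately have "t < A i" by simp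
      then show "share m r A t i = share m' r' A t i"
        using r[OF t(1)] r'[OF t(1)] i by metis
    qed
    moreover have "card (intact A t) * D + j mod D = j" unfolding c c_def by simp
    ultimately show "m div p ^ j mod p = m' div p ^ j mod p" unfolding digit_def by simp
  qed
qed

end

text \<open>The set \<open>Z\<close> encloses all links that Calvin reads or writes, padded to
  exactly \<open>z\<close> links so that it matches the number of random coefficients.\<close>

locale attack = scheme +
  fixes Zr Zw Z :: "nat set" and adv :: "signal \<Rightarrow> nat \<Rightarrow> nat \<Rightarrow> nat"
  assumes Z_sub: "Z \<subseteq> {..<C}" and card_Z: "card Z = z" and Zr_sub: "Zr \<subseteq> Z" and Zw_sub: "Zw \<subseteq> Z"
    and adv_less: "\<And>x t i. t < n \<Longrightarrow> i \<in> Zw \<Longrightarrow> adv x t i < p"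
    and adv_causal: "\<And>x x' t i. (\<And>s j. s \<le> t \<Longrightarrow> j \<in> Zr \<Longrightarrow> x s j = x' s j) \<Longrightarrow> adv x t i = adv x' t i"
begin

section \<open>Runs of the scheme under a fixed attack\<close>

definition X :: "nat \<Rightarrow> (nat \<times> nat \<Rightarrow> nat) \<Rightarrow> signal" where
  "X m u = fst (exec C encode Zw adv m u n)"

definition Y :: "nat \<Rightarrow> (nat \<times> nat \<Rightarrow> nat) \<Rightarrow> signal" where
  "Y m u = snd (exec C encode Zw adv m u n)"

abbreviation rec :: "nat \<Rightarrow> (nat \<times> nat \<Rightarrow> nat) \<Rightarrow> nat \<Rightarrow> nat \<Rightarrow> nat" where
  "rec m u t \<equiv> jamrec m u (Y m u) t"

lemma finite_Z: "finite Z" using Z_sub finite_subset by blast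

lemma clean_link: "\<exists>j<C. j \<notin> Z"
proof (rule ccontr)
  assume "\<not> (\<exists>j<C. j \<notin> Z)"
  then have "card {..<C} \<le> card Z" using finite_Z by (intro card_mono) auto
  then show False using card_Z D_pos by simp
qed

text \<open>By causality the encoder may be evaluated on the complete received word instead of its
  prefix.\<close>

lemma X_eq:
  assumes "t < n" "i < C"
  shows "X m u t i = encode m u (Y m u) t i"
proof -
  have "X m u t i = encode m u (snd (exec C encode Zw adv m u t)) t i"
    using assms by (simp add: X_def exec_fst_nth)
  also have "\<dots> = encode m u (Y m u) t i"
    using assms by (intro encode_causal) (simp add: Y_def exec_snd_stable[of _ t n])
  finally show ?thesis .
qed

lemma Y_jam:
  assumes "t < n" "i \<in> Zw"
  shows "Y m u t i = adv (X m u) t i"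
proof -
  have "i < C" using assms Zw_sub Z_sub by auto
  then have "Y m u t i = adv (fst (exec C encode Zw adv m u (Suc t))) t i"
    using assms by (simp add: Y_def exec_snd_nth del: exec.simps)
  also have "\<dots> = adv (X m u) t i"
    using assms by (intro adv_causal) (simp add: X_def exec_fst_nth del: exec.simps)
  finally show ?thesis .
qed

lemma Y_clean: "t < n \<Longrightarrow> i < C \<Longrightarrow> i \<notin> Zw \<Longrightarrow> Y m u t i = X m u t i"
  by (simp add: X_def Y_def exec_snd_nth)

lemma X_less: "t < n \<Longrightarrow> i < C \<Longrightarrow> X m u t i < p"
  by (simp add: X_eq encode_less)

lemma X_key:
  assumes "u \<in> rands" "t < 2" "i < C"
  shows "X m u t i = u (t, i)"
  using assms n_ge rands_less[OF assms(1), of t i] by (simp add: X_eq encode_def)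

lemma X_data: "2 \<le> t \<Longrightarrow> t < n - 2 \<Longrightarrow> i < C \<Longrightarrow> X m u t i = share m u (rec m u t) t i"
  by (simp add: X_eq encode_def)

lemma X_record: "i < C \<Longrightarrow> X m u (n - 2) i = h (rec m u (n - 2))"
  using n_ge by (simp add: X_eq encode_def)

lemma X_tag: "i < C \<Longrightarrow> X m u (n - 1) i = tag (Y m u) (h (rec m u (n - 2)))"
  using n_ge by (auto simp: X_eq encode_def)

text \<open>A symbol received on \<open>Z\<close> is either Calvin's, computed from what he read on
  \<open>Zr\<close>, or the symbol sent; both are determined by the past on
  \<open>Z\<close>.\<close>

lemma Y_agree:
  assumes "t < n" "\<And>s i. s \<le> t \<Longrightarrow> i \<in> Z \<Longrightarrow> X m u s i = X m' u' s i" "i \<in> Z"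
  shows "Y m u t i = Y m' u' t i"
proof (cases "i \<in> Zw")
  case True
  have "adv (X m u) t i = adv (X m' u') t i"
    using assms(2) Zr_sub by (intro adv_causal) auto
  then show ?thesis using Y_jam[OF assms(1) True] by simp
next
  case False
  then show ?thesis using Y_clean assms Z_sub by auto
qed

lemma rec_Suc:
  assumes "t < n"
  shows "rec m u (Suc t) = (\<lambda>i. if rec m u t i = n \<and> 2 \<le> t \<and> t < n - 2 \<and> i < C \<and> Y m u t i \<noteq> X m u t i
     then t else rec m u t i)"
  using X_data[of t _ m u] by (auto simp: fun_eq_iff)

lemma rec_clean:
  assumes "t \<le> n" "i < C" "i \<notin> Zw"
  shows "rec m u t i = n"
  using assms(1)
proof (induction t)
  case (Suc t)
  then show ?case using rec_Suc[of t m u] Y_clean[of t i m u] assms by auto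
qed (use assms in simp)

text \<open>Links outside \<open>Z\<close> are never jammed, so the record is a function of the
  traffic on \<open>Z\<close>.\<close>

lemma rec_agree:
  assumes "t \<le> n" "\<And>s i. s < t \<Longrightarrow> i \<in> Z \<Longrightarrow> X m u s i = X m' u' s i"
  shows "rec m u t = rec m' u' t"
  using assms
proof (induction t)
  case (Suc t)
  have IH: "rec m u t = rec m' u' t" using Suc by simp
  have "Y m u t i \<noteq> X m u t i \<longleftrightarrow> Y m' u' t i \<noteq> X m' u' t i" if "i < C" for i
  proof (cases "i \<in> Z")
    case True
    then have "Y m u t i = Y m' u' t i" using Suc.prems by (intro Y_agree) auto
    then show ?thesis using Suc.prems True by simp
  next
    case False
    then have "i \<notin> Zw" using Zw_sub by auto
    then show ?thesis using Y_clean[of t i] Suc.prems that by simp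
  qed
  then show ?case using IH Suc.prems by (auto simp: rec_Suc fun_eq_iff simp del: jamrec.simps)
qed simp

lemma jammed_sub:
  assumes "t \<le> n" "s \<le> n"
  shows "jammed (rec m u t) s \<subseteq> Zw"
proof
  fix i assume i: "i \<in> jammed (rec m u t) s"
  show "i \<in> Zw"
  proof (rule ccontr)
    assume "i \<notin> Zw"
    then have "rec m u t i = n" using i assms by (intro rec_clean) (auto simp: jammed_def)
    then show False using i assms by (simp add: jammed_def)
  qed
qed

subsection \<open>Secrecy\<close>

text \<open>The enumeration depends on the jammed set alone, so two runs with equal records list the
  same links in the same order.\<close>

definition order_rest :: "nat set \<Rightarrow> nat \<Rightarrow> nat" where
  "order_rest B = (SOME f. bij_betw f {..<card (Z - B)} (Z - B))"

lemma order_rest: "bij_betw (order_rest B) {..<card (Z - B)} (Z - B)"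
proof -
  have "finite (Z - B)" using finite_Z by simp
  then have "\<exists>f. bij_betw f {..<card (Z - B)} (Z - B)"
    using ex_bij_betw_nat_finite[of "Z - B"] by (simp add: atLeast0LessThan)
  then show ?thesis unfolding order_rest_def by (rule someI_ex)
qed

text \<open>The randomness is re-coordinatised: the random coefficients used at a data step are replaced by
  the shares sent on \<open>Z\<close>. These new coordinates determine everything that happens on \<open>Z\<close>,
  whatever the message is.\<close>

definition recoord :: "nat \<Rightarrow> (nat \<times> nat \<Rightarrow> nat) \<Rightarrow> nat \<times> nat \<Rightarrow> nat" where
  "recoord m u = (\<lambda>(t, k).
     if 2 \<le> t \<and> t < n - 2 \<and> k < z - card (jammed (rec m u t) t)
     then X m u t (order_rest (jammed (rec m u t) t) k) else u (t, k))"

lemma card_rest: "t \<le> n \<Longrightarrow> card (Z - jammed (rec m u t) t) = z - card (jammed (rec m u t) t)"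
  using jammed_sub[of t t m u] Zw_sub finite_Z card_Z
  by (subst card_Diff_subset) (auto intro: finite_subset)

lemma order_rest_in:
  assumes "t \<le> n" "k < z - card (jammed (rec m u t) t)"
  shows "order_rest (jammed (rec m u t) t) k \<in> Z - jammed (rec m u t) t"
proof -
  have "k \<in> {..<card (Z - jammed (rec m u t) t)}" using assms card_rest by simp
  then show ?thesis using bij_betwE[OF order_rest] by blast
qed

lemma recoord_rands:
  assumes "u \<in> rands"
  shows "recoord m u \<in> rands"
proof -
  have "X m u t (order_rest (jammed (rec m u t) t) k) < p"
    if "t < n - 2" "k < z - card (jammed (rec m u t) t)" for t k
  proof (rule X_less)
    show "t < n" using that by simp
    then show "order_rest (jammed (rec m u t) t) k < C"
      using order_rest_in[of t k m u] that Z_sub by auto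
  qed
  then show ?thesis
    using assms unfolding rands_def recoord_def by (auto simp: PiE_iff extensional_def)
qed

text \<open>Induction on time, for possibly different messages. Agreement on \<open>Z\<close> so far
  gives equal records; then a jammed link carries 0 in both runs, and the shares on the rest of
  \<open>Z\<close> are coordinates of \<open>recoord\<close>.\<close>

lemma recoord_agree:
  assumes "u \<in> rands" "u' \<in> rands" "recoord m u = recoord m' u'"
  shows "t < n \<Longrightarrow> i \<in> Z \<Longrightarrow> X m u t i = X m' u' t i"
proof (induction t arbitrary: i rule: less_induct)
  case (less t)
  have agree: "X m u s j = X m' u' s j" if "s < t" "j \<in> Z" for s j
    using less that by simp
  have iC: "i < C" using less Z_sub by auto
  have recs: "rec m u s = rec m' u' s" if "s \<le> t" for s
    using that less.prems agree by (intro rec_agree) auto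
  have keys: "u (s, j) = u' (s, j)" if "s < 2" for s j
    using fun_cong[OF assms(3), of "(s, j)"] that by (simp add: recoord_def)
  consider "t < 2" | "2 \<le> t" "t < n - 2" | "t = n - 2" | "t = n - 1" "t \<ge> 2"
    using less.prems n_ge by linarith
  then show ?case
  proof cases
    case 1
    then show ?thesis using X_key assms(1,2) iC keys by simp
  next
    case 2
    let ?B = "jammed (rec m u t) t"
    show ?thesis
    proof (cases "i \<in> ?B")
      case True
      then have "rec m u t i < t" by (simp add: jammed_def)
      then show ?thesis using X_data[OF 2 iC] recs[of t] by (simp add: share_def)
    next
      case False
      have "i \<in> order_rest ?B ` {..<card (Z - ?B)}"
        using order_rest[of ?B] False less.prems by (simp add: bij_betw_def)
      then obtain k where k: "k < z - card ?B" "i = order_rest ?B k"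
        using card_rest[of t m u] less.prems by auto
      show ?thesis
        using fun_cong[OF assms(3), of "(t, k)"] 2 k recs[of t] by (simp add: recoord_def)
    qed
  next
    case 3
    then show ?thesis using X_record[OF iC] recs[of t] by simp
  next
    case 4
    \<comment> \<open>The key also sums over links outside \<open>Z\<close>; their symbols are
      coordinates that \<open>recoord\<close> keeps.\<close>
    have "Y m u s j = Y m' u' s j" if "s < 2" "j < C" for s j
    proof (cases "j \<in> Z")
      case True
      then show ?thesis using that agree 4 less.prems by (intro Y_agree) auto
    next
      case False
      then have "j \<notin> Zw" using Zw_sub by auto
      then show ?thesis using that Y_clean[of s j] X_key assms(1,2) keys n_ge by simp
    qed
    then have "key (Y m u) s = key (Y m' u') s" if "s < 2" for s
      unfolding key_def using that by simp
    then show ?thesis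
      using X_tag[OF iC] recs[of "n - 2"] 4 by (simp add: tag_def)
  qed
qed

text \<open>Equal coordinates force equal traffic on \<open>Z\<close>. For a fixed message, the
  shares on the unjammed part of \<open>Z\<close> give back the random coefficients by
  \<open>shares_inj_rand\<close>.\<close>

lemma inj_on_recoord: "inj_on (recoord m) rands"
proof (rule inj_onI)
  fix u u' assume u: "u \<in> rands" "u' \<in> rands" and eq: "recoord m u = recoord m u'"
  note agree = recoord_agree[OF u eq]
  have recs: "rec m u t = rec m u' t" if "t \<le> n" for t
    using that agree by (intro rec_agree) auto
  show "u = u'"
  proof
    fix tk :: "nat \<times> nat"
    obtain t k where tk: "tk = (t, k)" by fastforce
    show "u tk = u' tk"
    proof (cases "2 \<le> t \<and> t < n - 2 \<and> k < z - card (jammed (rec m u t) t)")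
      case False
      have "recoord m u (t, k) = u (t, k)" using False by (auto simp: recoord_def)
      moreover have "\<not> (2 \<le> t \<and> t < n - 2 \<and> k < z - card (jammed (rec m u' t) t))"
        using False recs[of t] by (cases "t \<le> n") auto
      then have "recoord m u' (t, k) = u' (t, k)" by (auto simp: recoord_def)
      ultimately show ?thesis using eq tk by simp
    next
      case True
      let ?A = "rec m u t"
      let ?S = "Z - jammed ?A t"
      have "t \<le> n" using True by auto
      then have recs_t: "rec m u t = rec m u' t" by (rule recs)
      have "u (t, k) = u' (t, k)"
      proof (rule shares_inj_rand)
        show "?S \<subseteq> {..<C} - jammed ?A t" using Z_sub by auto
        show "card ?S = z - card (jammed ?A t)" using True by (intro card_rest) auto
        show "k < z - card (jammed ?A t)" using True by simp
        show "u (t, k) < p" "u' (t, k) < p" using rands_less u True by auto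
        show "share m u ?A t i = share m u' ?A t i" if "i \<in> ?S" for i
        proof -
          have "i < C" using that Z_sub by auto
          then have "X m u t i = share m u ?A t i" "X m u' t i = share m u' ?A t i"
            using X_data[of t i m u] X_data[of t i m u'] recs_t True by simp_all
          moreover have "t < n" using True by auto
          ultimately show ?thesis using agree[of t i] that by simp
        qed
      qed
      then show ?thesis using tk by simp
    qed
  qed
qed

text \<open>\<open>recoord m\<close> permutes \<open>rands\<close>, so it preserves the uniform law,
  and the view is one and the same function of the new coordinates for every message.\<close>

lemma view_law:
  "map_pmf (view C n encode Zw Zr adv m) (pmf_of_set rands) =
   map_pmf (view C n encode Zw Zr adv m') (pmf_of_set rands)"
proof -
  have view: "view C n encode Zw Zr adv m u = (\<lambda>t j. if j \<in> Zr then X m u t j else undefined)" for m u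
    unfolding view_def X_def ..
  have surj: "recoord m ` rands = rands" for m
    using inj_on_recoord recoord_rands finite_rands by (intro endo_inj_surj) auto
  \<comment> \<open>Message 0 is an arbitrary reference from which this common function is read
    off.\<close>
  define F where "F = (\<lambda>v. view C n encode Zw Zr adv 0 (inv_into rands (recoord 0) v))"
  have F: "view C n encode Zw Zr adv m u = F (recoord m u)" if u: "u \<in> rands" for m u
  proof -
    define u' where "u' = inv_into rands (recoord 0) (recoord m u)"
    have "recoord m u \<in> recoord 0 ` rands" using surj recoord_rands[OF u] by simp
    then have u': "u' \<in> rands" "recoord 0 u' = recoord m u"
      unfolding u'_def by (rule inv_into_into, rule f_inv_into_f)
    have "X m u t j = X 0 u' t j" if "j \<in> Zr" for t j
    proof (cases "t < n")
      case True
      then show ?thesis using recoord_agree[OF u u'(1) u'(2)[symmetric]] that Zr_sub by auto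
    next
      case False
      then show ?thesis by (simp add: X_def exec_beyond)
    qed
    then show ?thesis unfolding F_def u'_def[symmetric] view by (simp add: fun_eq_iff)
  qed
  have law: "map_pmf (view C n encode Zw Zr adv m) (pmf_of_set rands) = map_pmf F (pmf_of_set rands)" for m
  proof -
    have "map_pmf (view C n encode Zw Zr adv m) (pmf_of_set rands) =
          map_pmf F (map_pmf (recoord m) (pmf_of_set rands))"
      unfolding pmf.map_comp o_def
      by (rule map_pmf_cong[OF refl]) (rule F, simp add: finite_rands rands_nonempty)
    also have "map_pmf (recoord m) (pmf_of_set rands) = pmf_of_set rands"
      using map_pmf_of_set_inj[OF inj_on_recoord rands_nonempty finite_rands] surj[of m] by (simp only:)
    finally show ?thesis .
  qed
  show ?thesis by (simp only: law)
qed

subsection \<open>Reliability\<close>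

definition forged :: "nat \<Rightarrow> nat \<Rightarrow> (nat \<times> nat \<Rightarrow> nat) \<Rightarrow> bool" where
  "forged m i u \<longleftrightarrow> Y m u (n - 2) i \<noteq> h (rec m u (n - 2)) \<and>
     Y m u (n - 1) i = tag (Y m u) (Y m u (n - 2) i)"

text \<open>Without a forgery every accepted record is the true one, and the true record admits only
  one consistent message.\<close>

lemma decode_correct:
  assumes "K \<le> p ^ (D * (n - 4 - z))" "m < K"
    and no: "\<And>i. i \<in> Zw \<Longrightarrow> \<not> forged m i u"
  shows "decode K (Y m u) = m"
proof -
  let ?A = "rec m u (n - 2)" and ?y = "Y m u"
  have cardZw: "card Zw \<le> z" using card_mono[OF finite_Z Zw_sub] card_Z by simp
  have finZw: "finite Zw" using finite_Z Zw_sub finite_subset by blast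
  have A: "?A \<in> PiE {..<C} (\<lambda>_. {..n})" by (rule jamrec_PiE)
  have small: "card (jammed ?A t) \<le> z" if "t \<in> intact ?A (n - 2)" for t
  proof -
    have "jammed ?A t \<subseteq> Zw" using that by (intro jammed_sub) (auto simp: intact_def)
    then show ?thesis using card_mono[OF finZw, of "jammed ?A t"] cardZw by simp
  qed
  \<comment> \<open>Each link of \<open>Zw\<close> spoils at most one of the \<open>n - 4\<close>
    data steps, namely that of its first jamming.\<close>
  have many: "n - 4 - z \<le> card (intact ?A (n - 2))"
  proof -
    have "{2..<n - 2} - ?A ` Zw \<subseteq> intact ?A (n - 2)"
    proof
      fix t assume t: "t \<in> {2..<n - 2} - ?A ` Zw"
      have "t \<noteq> ?A i" if "i < C" for i
        using t that rec_clean[of "n - 2" i m u] by (cases "i \<in> Zw") auto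
      then show "t \<in> intact ?A (n - 2)" using t unfolding intact_def by auto
    qed
    then have "card ({2..<n - 2} - ?A ` Zw) \<le> card (intact ?A (n - 2))"
      by (intro card_mono) (auto simp: intact_def)
    moreover have "card {2..<n - 2} - card (?A ` Zw) \<le> card ({2..<n - 2} - ?A ` Zw)"
      using finZw by (intro diff_card_le_card_Diff) simp
    moreover have "card (?A ` Zw) \<le> z" using card_image_le[OF finZw, of ?A] cardZw by simp
    moreover have "card {2..<n - 2} = n - 4" by simp
    ultimately show ?thesis by linarith
  qed
  have cons: "consistent ?y ?A m"
    unfolding consistent_def
  proof (intro exI[of _ u] ballI allI impI)
    fix t i assume ti: "t \<in> intact ?A (n - 2)" "i < C" "t < ?A i"
    then have t: "2 \<le> t" "t < n - 2" by (auto simp: intact_def)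
    then have "?y t i = share m u (rec m u t) t i" using ti by (intro jamrec_gtD) auto
    also have "\<dots> = share m u ?A t i" using ti t by (intro share_jamrec) auto
    finally show "?y t i = share m u ?A t i" .
  qed
  \<comment> \<open>A link outside \<open>Z\<close> delivers record and tag untouched.\<close>
  have acc: "accepted ?y (h ?A)"
  proof -
    obtain j where j: "j < C" "j \<notin> Zw" using clean_link Zw_sub by blast
    then show ?thesis
      using X_record[of j m u] X_tag[of j m u] Y_clean[of "n - 2" j m u] Y_clean[of "n - 1" j m u] n_ge
      unfolding accepted_def by auto
  qed
  have unique: "m' = m"
    if m': "m' < K" "A' \<in> PiE {..<C} (\<lambda>_. {..n})" "accepted ?y (h A')" "consistent ?y A' m'" for m' A'
  proof -
    obtain i where i: "i < C" "?y (n - 2) i = h A'" "?y (n - 1) i = tag ?y (h A')"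
      using m'(3) unfolding accepted_def by blast
    have "h A' = h ?A"
    proof (cases "i \<in> Zw")
      case True
      then show ?thesis using no[OF True] i unfolding forged_def by auto
    next
      case False
      then show ?thesis using i X_record[of i m u] Y_clean[of "n - 2" i m u] n_ge by simp
    qed
    then have "A' = ?A" using inj_onD[OF inj_h] m'(2) A by blast
    then show ?thesis
      using consistent_unique[OF _ cons small many, of m'] m' assms(1,2) by auto
  qed
  show ?thesis
    unfolding decode_def using assms(2) A acc cons unique by (intro some_equality) auto
qed

section \<open>Forging a tag: two points determine the key modulo \<open>p\<close>\<close>

lemma tag_eq_inj:
  assumes "tag y w = tag y' w" "tag y v = tag y' v" "v \<noteq> w" "v < p" "w < p"
  shows "int p dvd int (key y 0) - int (key y' 0)" "int p dvd int (key y 1) - int (key y' 1)"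
proof -
  have dvd: "int p dvd (int (key y 0) - int (key y' 0)) * int w + (int (key y 1) - int (key y' 1))"
    if "tag y w = tag y' w" for w
  proof -
    have "int (key y 0 * w + key y 1) mod int p = int (key y' 0 * w + key y' 1) mod int p"
      using that unfolding tag_def zmod_int[symmetric] by simp
    then show ?thesis unfolding mod_eq_dvd_iff by (simp add: algebra_simps)
  qed
  have "int p dvd (int (key y 0) - int (key y' 0)) * (int v - int w)"
    using dvd_diff[OF dvd[OF assms(2)] dvd[OF assms(1)]] by (simp add: algebra_simps)
  moreover have "\<not> int p dvd int v - int w"
    using eq_if_mod_diff_dvd[of v p w] assms by blast
  ultimately show *: "int p dvd int (key y 0) - int (key y' 0)"
    using prime_dvd_mult_iff[of "int p"] prime by (metis prime_nat_int_transfer)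
  show "int p dvd int (key y 1) - int (key y' 1)"
    using dvd[OF assms(1)] dvd_mult2[OF *, of "int w"] dvd_add_right_iff by blast
qed

text \<open>Calvin does not see the key symbols of link \<open>j\<close>, and nothing sent between
  the key steps and the tag depends on the key. The tag is the same on all links, so agreement on
  \<open>j\<close> suffices.\<close>

lemma keys_agree:
  assumes "u \<in> rands" "u' \<in> rands" and j: "j < C" "j \<notin> Z"
    and eq: "\<And>t k. (t, k) \<noteq> (0, j) \<Longrightarrow> (t, k) \<noteq> (1, j) \<Longrightarrow> u (t, k) = u' (t, k)"
    and tag: "X m u (n - 1) j = X m u' (n - 1) j"
  shows "t < n \<Longrightarrow> i < C \<Longrightarrow> t < 2 \<longrightarrow> i \<noteq> j \<Longrightarrow> X m u t i = X m u' t i"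
proof (induction t arbitrary: i rule: less_induct)
  case (less t)
  have recs: "rec m u s = rec m u' s" if "s \<le> t" for s
  proof (rule rec_agree)
    show "s \<le> n" using that less.prems by simp
    show "X m u s' k = X m u' s' k" if "s' < s" "k \<in> Z" for s' k
      using less.IH[of s' k] less.prems \<open>s \<le> t\<close> that j Z_sub by auto
  qed
  consider "t < 2" | "2 \<le> t" "t < n - 2" | "t = n - 2" | "t = n - 1"
    using less.prems n_ge by linarith
  then show ?case
  proof cases
    case 1
    then show ?thesis using X_key assms(1,2) less.prems eq[of t i] by auto
  next
    case 2
    then have "u (t, k) = u' (t, k)" for k by (intro eq) auto
    then have "share m u A t i = share m u' A t i" for A by (simp add: share_def)
    then show ?thesis using X_data[OF 2 less.prems(2)] recs[of t] by simp
  next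
    case 3
    then show ?thesis using X_record less.prems(2) recs[of t] by simp
  next
    case 4
    then show ?thesis using tag X_tag[OF less.prems(2)] X_tag[OF j(1)] by simp
  qed
qed

text \<open>Calvin knows the tag of the true record \<open>w\<close>. A second valid pair \<open>(w', t')\<close> with \<open>w' \<noteq> w\<close> then
  determines the key, hence the two symbols that mask it on the clean link \<open>j\<close>.\<close>

lemma inj_on_forged:
  assumes j: "j < C" "j \<notin> Z" and i: "i \<in> Zw"
  shows "inj_on (\<lambda>u. u((0, j) := 0, (1, j) := X m u (n - 1) j)) {u \<in> rands. forged m i u}"
proof (rule inj_onI)
  fix u u'
  assume "u \<in> {u \<in> rands. forged m i u}" "u' \<in> {u \<in> rands. forged m i u}"
  then have u: "u \<in> rands" "forged m i u" and u': "u' \<in> rands" "forged m i u'" by auto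
  assume eq: "u((0, j) := 0, (1, j) := X m u (n - 1) j) = u'((0, j) := 0, (1, j) := X m u' (n - 1) j)"
  have rest: "u (t, k) = u' (t, k)" if "(t, k) \<noteq> (0, j)" "(t, k) \<noteq> (1, j)" for t k
    using fun_cong[OF eq, of "(t, k)"] that by (simp add: fun_upd_def split: if_splits)
  have tag: "X m u (n - 1) j = X m u' (n - 1) j"
    using fun_cong[OF eq, of "(1, j)"] by simp
  note agree = keys_agree[OF u(1) u'(1) j rest tag]
  have agreeZ: "X m u t k = X m u' t k" if "t < n" "k \<in> Z" for t k
    using agree[of t k] that j Z_sub by auto
  have YZ: "Y m u t k = Y m u' t k" if "t < n" "k \<in> Z" for t k
    using agreeZ that by (intro Y_agree) auto
  have recs: "rec m u (n - 2) = rec m u' (n - 2)"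
    using agreeZ by (intro rec_agree) auto
  have Ykey: "Y m u t k = Y m u' t k" if "t < 2" "k < C" "k \<noteq> j" for t k
  proof (cases "k \<in> Z")
    case True
    then show ?thesis using that n_ge by (intro YZ) auto
  next
    case False
    then have "k \<notin> Zw" using Zw_sub by auto
    then show ?thesis using that agree[of t k] Y_clean[of t k] n_ge by auto
  qed
  \<comment> \<open>Both sums have equal terms except on link \<open>j\<close>, where Bob receives
    Alice's random symbol unchanged.\<close>
  have key: "int (key (Y m u) t) - int (key (Y m u') t) = int (u (t, j)) - int (u' (t, j))" if "t < 2" for t
  proof -
    have jw: "j \<notin> Zw" using j Zw_sub by auto
    have split: "key y t = y t j + (\<Sum>k\<in>{..<C} - {j}. y t k)" for y
      unfolding key_def using j by (intro sum.remove) auto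
    have "(\<Sum>k\<in>{..<C} - {j}. Y m u t k) = (\<Sum>k\<in>{..<C} - {j}. Y m u' t k)"
      using Ykey that by (intro sum.cong) auto
    moreover have "Y m u t j = u (t, j)" "Y m u' t j = u' (t, j)"
      using Y_clean[of t j] X_key[of _ t j] u u' j jw that n_ge by auto
    ultimately show ?thesis using split by simp
  qed
  have iZ: "i \<in> Z" using i Zw_sub by auto
  define w where "w = h (rec m u (n - 2))"
  define v where "v = Y m u (n - 2) i"
  have v: "v \<noteq> w" "v < p" "w < p"
    using u(2) Y_jam[OF _ i, of "n - 2" m u] adv_less[OF _ i, of "n - 2"] h_less n_ge
    unfolding forged_def w_def v_def by auto
  have tw: "tag (Y m u) w = tag (Y m u') w"
    using tag X_tag[OF j(1)] recs unfolding w_def by simp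
  have tv: "tag (Y m u) v = tag (Y m u') v"
    using u(2) u'(2) YZ[OF _ iZ, of "n - 2"] YZ[OF _ iZ, of "n - 1"] n_ge
    unfolding forged_def v_def by simp
  have "int p dvd int (u (0, j)) - int (u' (0, j))" "int p dvd int (u (1, j)) - int (u' (1, j))"
    using tag_eq_inj[OF tw tv v] key[of 0] key[of 1] by simp_all
  then have "u (0, j) = u' (0, j)" "u (1, j) = u' (1, j)"
    using rands_less[OF u(1) _ j(1)] rands_less[OF u'(1) _ j(1)] n_ge
    by (auto intro!: eq_if_mod_diff_dvd[of _ p])
  then have "u (t, k) = u' (t, k)" for t k using rest[of t k] by metis
  then show "u = u'" by (intro ext) (metis surj_pair)
qed

text \<open>\<open>inj_on_forged\<close> embeds the forging randomness into the part of
  \<open>rands\<close> with \<open>u (0, j) = 0\<close>, which is at most a fraction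
  \<open>1 / p\<close> of the whole.\<close>

lemma prob_forged:
  assumes i: "i \<in> Zw"
  shows "measure_pmf.prob (pmf_of_set rands) {u. forged m i u} \<le> 1 / real p"
proof -
  obtain j where j: "j < C" "j \<notin> Z" using clean_link by blast
  let ?E = "{u \<in> rands. forged m i u}" and ?R = "{u \<in> rands. u (0, j) = 0}"
  let ?f = "\<lambda>u. u((0, j) := 0, (1, j) := X m u (n - 1) j)"
  have "?f ` ?E \<subseteq> ?R"
  proof
    fix v assume "v \<in> ?f ` ?E"
    then obtain u where u: "u \<in> rands" "v = ?f u" by blast
    have "X m u (n - 1) j < p" using j n_ge by (intro X_less) auto
    then have "v \<in> rands"
      using u j p_pos n_ge by (simp add: rands_upd)
    then show "v \<in> ?R" using u by simp
  qed
  then have "card ?E \<le> card ?R"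
    using card_inj_on_le[OF inj_on_forged[OF j i]] finite_rands by auto
  moreover have "p * card ?R \<le> card rands"
  proof -
    \<comment> \<open>Refilling coordinate \<open>(0, j)\<close> with any of \<open>p\<close> values
      yields distinct elements of \<open>rands\<close>.\<close>
    have "inj_on (\<lambda>(a, u). u((0, j) := a)) ({..<p} \<times> ?R)"
    proof (rule inj_onI, clarsimp)
      fix a b u v
      assume *: "u (0, j) = 0" "v (0, j) = 0" "u((0, j) := a) = v((0, j) := b)"
      have "a = b" using fun_cong[OF *(3), of "(0, j)"] by simp
      moreover have "u = v" using * by (metis fun_upd_triv fun_upd_upd)
      ultimately show "a = b \<and> u = v" by simp
    qed
    moreover have "(\<lambda>(a, u). u((0, j) := a)) ` ({..<p} \<times> ?R) \<subseteq> rands"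
      using j n_ge by (auto intro!: rands_upd)
    ultimately have "card ({..<p} \<times> ?R) \<le> card rands"
      using finite_rands by (intro card_inj_on_le) auto
    then show ?thesis by (simp add: card_cartesian_product)
  qed
  ultimately have "p * card ?E \<le> card rands" by (meson le_trans mult_le_mono2)
  then have "real p * real (card ?E) \<le> real (card rands)" by (metis of_nat_le_iff of_nat_mult)
  moreover have "card rands > 0" using finite_rands rands_nonempty by (simp add: card_gt_0_iff)
  ultimately have "real (card ?E) / real (card rands) \<le> 1 / real p"
    using p_pos by (simp add: field_simps)
  moreover have "rands \<inter> {u. forged m i u} = ?E" by blast
  ultimately show ?thesis using finite_rands rands_nonempty by (simp add: measure_pmf_of_set)
qed

lemma prob_decode_wrong:
  assumes "K \<le> p ^ (D * (n - 4 - z))" "m < K"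
  shows "measure_pmf.prob (pmf_of_set rands) {u. decode K (Y m u) \<noteq> m} \<le> real C / real p"
proof -
  have finZw: "finite Zw" using finite_Z Zw_sub finite_subset by blast
  have "measure_pmf.prob (pmf_of_set rands) {u. decode K (Y m u) \<noteq> m}
      \<le> measure_pmf.prob (pmf_of_set rands) (\<Union>i\<in>Zw. {u. forged m i u})"
    using decode_correct[OF assms] by (intro measure_pmf.finite_measure_mono) auto
  also have "\<dots> \<le> (\<Sum>i\<in>Zw. measure_pmf.prob (pmf_of_set rands) {u. forged m i u})"
    using finZw by (intro measure_pmf.finite_measure_subadditive_finite) auto
  also have "\<dots> \<le> (\<Sum>i\<in>Zw. 1 / real p)"
    by (intro sum_mono prob_forged)
  also have "\<dots> = real (card Zw) / real p" by simp
  also have "\<dots> \<le> real C / real p"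
  proof -
    have "card Zw \<le> card {..<C}" using Zw_sub Z_sub by (intro card_mono) auto
    then have "real (card Zw) \<le> real C" by (intro of_nat_mono) simp
    then show ?thesis by (rule divide_right_mono) simp
  qed
  finally show ?thesis .
qed

end

subsection \<open>Achievability\<close>

context scheme
begin

lemma valid_encode: "valid_code C p n id (\<lambda>m v. encode m (g v))"
  unfolding valid_code_def
proof (intro conjI allI impI)
  fix m u y y' t i
  assume "agree_on {(t', j). id t' < id t} y y'"
  then show "encode m (g u) y t i = encode m (g u) y' t i"
    by (intro encode_causal) (auto simp: agree_on_def)
qed (auto simp: mono_def encode_less)

lemma attackI:
  assumes "admissible C p n zrw zro zwo Zrw Zro Zwo adv" "zrw + zro + zwo = z"
  obtains Z where "attack D z n p h (Zrw \<union> Zro) (Zrw \<union> Zwo) Z adv"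
proof -
  note adm = assms(1)[unfolded admissible_def]
  have causal: "adv x t i = adv x' t i"
    if "agree_on {(t', j). t' \<le> t \<and> j \<in> Zrw \<union> Zro} x x'" for x x' t i
    using adm that by simp
  let ?Z = "Zrw \<union> Zro \<union> Zwo"
  have "card ?Z \<le> card Zrw + card Zro + card Zwo"
    using card_Un_le[of "Zrw \<union> Zro" Zwo] card_Un_le[of Zrw Zro] by linarith
  also have "\<dots> \<le> z" using adm assms(2) by linarith
  finally have "card ?Z \<le> z" .
  moreover have "?Z \<subseteq> {..<C}" using adm by blast
  ultimately obtain Z where Z: "?Z \<subseteq> Z" "Z \<subseteq> {..<C}" "card Z = z"
    using exists_subset_between[of ?Z z "{..<C}"] by auto
  have "attack D z n p h (Zrw \<union> Zro) (Zrw \<union> Zwo) Z adv"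
  proof unfold_locales
    fix x x' :: signal and t i
    assume "\<And>s j. s \<le> t \<Longrightarrow> j \<in> Zrw \<union> Zro \<Longrightarrow> x s j = x' s j"
    then show "adv x t i = adv x' t i" by (intro causal) (auto simp: agree_on_def)
  next
    fix x t i assume "t < n" "i \<in> Zrw \<union> Zwo"
    then show "adv x t i < p" using adm by simp
  qed (use Z in auto)
  then show thesis by (rule that)
qed

lemma ex_code:
  assumes "zrw + zro + zwo = z" "K > 0" "K \<le> p ^ (D * (n - 4 - z))" "real C / real p < \<epsilon>"
  shows "\<exists>rd (pu :: nat pmf) enc dec. valid_code C p n rd enc \<and>
    (\<forall>Zrw Zro Zwo adv. admissible C p n zrw zro zwo Zrw Zro Zwo adv \<longrightarrow>
       error_prob C n K pu enc dec (Zrw \<union> Zwo) adv < \<epsilon> \<and>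
       perfectly_secret C n K pu enc (Zrw \<union> Zwo) (Zrw \<union> Zro) adv)"
proof -
  obtain g where g: "bij_betw g {..<card rands} rands"
    using ex_bij_betw_nat_finite[OF finite_rands] by (auto simp: atLeast0LessThan)
  define pu where "pu = pmf_of_set {..<card rands}"
  have "card rands > 0" using finite_rands rands_nonempty by (simp add: card_gt_0_iff)
  then have pu: "map_pmf g pu = pmf_of_set rands"
    unfolding pu_def using g
    by (subst map_pmf_of_set_inj) (auto simp: bij_betw_def lessThan_empty_iff)
  let ?enc = "\<lambda>m v. encode m (g v)"
  have "error_prob C n K pu ?enc (decode K) (Zrw \<union> Zwo) adv < \<epsilon> \<and>
        perfectly_secret C n K pu ?enc (Zrw \<union> Zwo) (Zrw \<union> Zro) adv"
    if adm: "admissible C p n zrw zro zwo Zrw Zro Zwo adv" for Zrw Zro Zwo adv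
  proof
    obtain Z where "attack D z n p h (Zrw \<union> Zro) (Zrw \<union> Zwo) Z adv"
      using attackI[OF adm assms(1)] .
    then interpret attack D z n p h "Zrw \<union> Zro" "Zrw \<union> Zwo" Z adv .
    have "error_prob C n K pu ?enc (decode K) (Zrw \<union> Zwo) adv =
      measure_pmf.prob (bind_pmf (pmf_of_set {..<K}) (\<lambda>m. map_pmf (Pair m) pu))
        {(m, v). decode K (Y m (g v)) \<noteq> m}"
      unfolding error_prob_def msg_rand_def pair_pmf_def map_pmf_def Y_def exec_reindex[of _ encode g] ..
    also have "\<dots> \<le> real C / real p"
    proof (rule prob_bind_pmf_le)
      fix m assume "m \<in> set_pmf (pmf_of_set {..<K})"
      then have m: "m < K" using assms(2) by (simp add: lessThan_empty_iff)
      have "measure_pmf.prob (map_pmf (Pair m) pu) {(m, v). decode K (Y m (g v)) \<noteq> m} =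
            measure_pmf.prob (map_pmf g pu) {u. decode K (Y m u) \<noteq> m}"
        by (simp add: vimage_def)
      also have "\<dots> \<le> real C / real p"
        unfolding pu by (rule prob_decode_wrong[OF assms(3) m])
      finally show "measure_pmf.prob (map_pmf (Pair m) pu) {(m, v). decode K (Y m (g v)) \<noteq> m}
          \<le> real C / real p" .
    qed
    finally show "error_prob C n K pu ?enc (decode K) (Zrw \<union> Zwo) adv < \<epsilon>"
      using assms(4) by simp
    show "perfectly_secret C n K pu ?enc (Zrw \<union> Zwo) (Zrw \<union> Zro) adv"
    proof (rule perfectly_secretI[OF assms(2)])
      fix m
      have "map_pmf (view C n ?enc (Zrw \<union> Zwo) (Zrw \<union> Zro) adv m) pu =
            map_pmf (view C n encode (Zrw \<union> Zwo) (Zrw \<union> Zro) adv m) (map_pmf g pu)"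
        unfolding pmf.map_comp o_def view_def exec_reindex[of _ encode g] ..
      also have "\<dots> = map_pmf (view C n encode (Zrw \<union> Zwo) (Zrw \<union> Zro) adv 0) (pmf_of_set rands)"
        unfolding pu by (rule view_law)
      finally show "map_pmf (view C n ?enc (Zrw \<union> Zwo) (Zrw \<union> Zro) adv m) pu =
        map_pmf (view C n encode (Zrw \<union> Zwo) (Zrw \<union> Zro) adv 0) (pmf_of_set rands)" .
    qed
  qed
  then show ?thesis using valid_encode by blast
qed

end

lemma ex_scheme:
  fixes D z n B :: nat
  assumes "D > 0" "n \<ge> 4"
  obtains p h where "p > B" "scheme D z n p h"
proof -
  let ?P = "PiE {..<D + z} (\<lambda>_. {..n})"
  obtain p where p: "prime p" "p > max B (max (D + z) (card ?P))"
    using bigger_prime by blast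
  have "finite ?P" by (intro finite_PiE) auto
  then obtain h0 where h0: "inj_on h0 ?P" "h0 ` ?P \<subseteq> {..<p}"
    using card_le_inj[of ?P "{..<p}"] p by auto
  \<comment> \<open>The value 0 off the set of records keeps \<open>h\<close> below \<open>p\<close>
    everywhere, as the locale demands.\<close>
  define h where "h = (\<lambda>A. if A \<in> ?P then h0 A else 0)"
  have "scheme D z n p h"
  proof
    show "h A < p" for A using h0(2) p unfolding h_def by auto
    have "inj_on h ?P \<longleftrightarrow> inj_on h0 ?P" by (rule inj_on_cong) (simp add: h_def)
    then show "inj_on h ?P" using h0(1) by simp
  qed (use p assms in auto)
  then show thesis using p by (intro that[of p h]) auto
qed

theorem achievable_lower_bound:
  assumes "zrw + zro + zwo < C" "R < real (C - (zrw + zro + zwo))"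
  shows "achievable C zrw zro zwo R"
  unfolding achievable_def
proof (intro allI impI)
  fix \<epsilon> :: real assume \<epsilon>: "\<epsilon> > 0"
  define z where "z = zrw + zro + zwo"
  define D where "D = C - z"
  have C: "C = D + z" and D: "D > 0" and R: "R < real D"
    using assms by (auto simp: D_def z_def)
  \<comment> \<open>Beyond \<open>N\<close> the slack \<open>n * (D - R)\<close> pays for the
    \<open>4 + z\<close> steps lost to key, record, tag and repetitions.\<close>
  obtain N :: nat where N: "real (D * (4 + z)) / (real D - R) \<le> real N"
    using real_arch_simple by blast
  show "\<exists>N. \<forall>n\<ge>N. \<exists>q K rd (pu :: nat pmf) enc dec.
        q \<ge> 2 \<and> K = nat \<lceil>real q powr (real n * R)\<rceil> \<and> valid_code C q n rd enc \<and>
        (\<forall>Zrw Zro Zwo adv. admissible C q n zrw zro zwo Zrw Zro Zwo adv \<longrightarrow>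
           error_prob C n K pu enc dec (Zrw \<union> Zwo) adv < \<epsilon> \<and>
           perfectly_secret C n K pu enc (Zrw \<union> Zwo) (Zrw \<union> Zro) adv)"
  proof (rule exI[of _ "max N (4 + z)"], intro allI impI)
    fix n assume n: "n \<ge> max N (4 + z)"
    \<comment> \<open>The alphabet is chosen after \<open>n\<close> and the error bound, so a prime
      above \<open>B\<close> brings \<open>C / p\<close> below that bound.\<close>
    obtain B :: nat where B: "real C / \<epsilon> < real B" using reals_Archimedean2 by blast
    have "n \<ge> 4" using n by simp
    then obtain p h where p: "p > B" and sch: "scheme D z n p h"
      by (rule ex_scheme[OF D])
    interpret scheme D z n p h by (rule sch)
    have p2: "p \<ge> 2" using prime by (rule prime_ge_2_nat)
    define K where "K = nat \<lceil>real p powr (real n * R)\<rceil>"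
    have K_pos: "K > 0" unfolding K_def using p2 by simp
    have "real (D * (4 + z)) \<le> real N * (real D - R)"
      using N R by (subst (asm) pos_divide_le_eq) auto
    also have "\<dots> \<le> real n * (real D - R)"
      using n R by (intro mult_right_mono) auto
    finally have "real (D * (4 + z)) \<le> real n * (real D - R)" .
    moreover have len: "real (D * (n - 4 - z)) = real D * (real n - 4 - real z)"
      using n by (simp add: of_nat_diff)
    ultimately have "real n * R \<le> real (D * (n - 4 - z))"
      unfolding len by (simp add: algebra_simps)
    then have "real p powr (real n * R) \<le> real p powr real (D * (n - 4 - z))"
      using p2 by (intro powr_mono) auto
    also have "\<dots> = real (p ^ (D * (n - 4 - z)))"
      using p2 by (simp only: powr_realpow of_nat_power)
    finally have "\<lceil>real p powr (real n * R)\<rceil> \<le> int (p ^ (D * (n - 4 - z)))"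
      by (simp add: ceiling_le_iff)
    then have K_le: "K \<le> p ^ (D * (n - 4 - z))"
      unfolding K_def by linarith
    have "real C < real B * \<epsilon>" using B \<epsilon> by (subst (asm) pos_divide_less_eq)
    also have "\<dots> \<le> real p * \<epsilon>" using p \<epsilon> by (intro mult_right_mono) auto
    finally have "real C < \<epsilon> * real p" by (simp only: mult.commute)
    then have "real (D + z) / real p < \<epsilon>"
      unfolding C[symmetric] using p_pos by (subst pos_divide_less_eq) auto
    from ex_code[OF z_def[symmetric] K_pos K_le this]
    obtain rd enc dec and pu :: "nat pmf" where code: "valid_code C p n rd enc"
      "\<forall>Zrw Zro Zwo adv. admissible C p n zrw zro zwo Zrw Zro Zwo adv \<longrightarrow>
         error_prob C n K pu enc dec (Zrw \<union> Zwo) adv < \<epsilon> \<and>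
         perfectly_secret C n K pu enc (Zrw \<union> Zwo) (Zrw \<union> Zro) adv"
      unfolding C[symmetric] by (elim exE conjE)
    show "\<exists>q K rd (pu :: nat pmf) enc dec.
        q \<ge> 2 \<and> K = nat \<lceil>real q powr (real n * R)\<rceil> \<and> valid_code C q n rd enc \<and>
        (\<forall>Zrw Zro Zwo adv. admissible C q n zrw zro zwo Zrw Zro Zwo adv \<longrightarrow>
           error_prob C n K pu enc dec (Zrw \<union> Zwo) adv < \<epsilon> \<and>
           perfectly_secret C n K pu enc (Zrw \<union> Zwo) (Zrw \<union> Zro) adv)"
      by (rule exI[of _ p], rule exI[of _ K], rule exI[of _ rd], rule exI[of _ pu],
          rule exI[of _ enc], rule exI[of _ dec]) (intro conjI p2 K_def code)
  qed
qed

lemma achievable_nonpos: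
  assumes "R \<le> 0"
  shows "achievable C zrw zro zwo R"
  unfolding achievable_def
proof (intro allI impI, rule exI[of _ 0], intro allI impI)
  fix \<epsilon> :: real and n :: nat assume \<epsilon>: "\<epsilon> > 0"
  define enc :: "nat \<Rightarrow> nat \<Rightarrow> signal \<Rightarrow> nat \<Rightarrow> nat \<Rightarrow> nat" where "enc = (\<lambda>_ _ _ _ _. 0)"
  have "2 powr (real n * R) \<le> (2 :: real) powr 0"
    using assms by (intro powr_mono) (auto simp: mult_nonneg_nonpos)
  then have "\<lceil>2 powr (real n * R)\<rceil> = 1"
    by (intro ceiling_unique) auto
  then have K: "1 = nat \<lceil>real 2 powr (real n * R)\<rceil>" by simp
  have code: "error_prob C n 1 (return_pmf 0) enc (\<lambda>_. 0) Zw adv < \<epsilon>"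
    "perfectly_secret C n 1 (return_pmf 0) enc Zw Zr adv" for Zw Zr adv
  proof -
    have "pmf_of_set {..<1::nat} = return_pmf 0" by (simp add: lessThan_Suc pmf_of_set_singleton)
    then show "error_prob C n 1 (return_pmf 0) enc (\<lambda>_. 0) Zw adv < \<epsilon>"
      using \<epsilon> by (simp add: error_prob_def msg_rand_def pair_return_pmf1)
    show "perfectly_secret C n 1 (return_pmf 0) enc Zw Zr adv"
      by (rule perfectly_secretI[where L = "map_pmf (view C n enc Zw Zr adv 0) (return_pmf 0)"]) auto
  qed
  have valid: "valid_code C 2 n id enc" by (simp add: valid_code_def enc_def mono_def)
  show "\<exists>q K rd (pu :: nat pmf) enc dec.
        q \<ge> 2 \<and> K = nat \<lceil>real q powr (real n * R)\<rceil> \<and> valid_code C q n rd enc \<and>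
        (\<forall>Zrw Zro Zwo adv. admissible C q n zrw zro zwo Zrw Zro Zwo adv \<longrightarrow>
           error_prob C n K pu enc dec (Zrw \<union> Zwo) adv < \<epsilon> \<and>
           perfectly_secret C n K pu enc (Zrw \<union> Zwo) (Zrw \<union> Zro) adv)"
    by (rule exI[of _ 2], rule exI[of _ 1], rule exI[of _ id], rule exI[of _ "return_pmf 0"],
        rule exI[of _ enc], rule exI[of _ "\<lambda>_. 0"]) (intro conjI K valid allI impI code order_refl)
qed

section \<open>The capacity as a supremum\<close>

theorem theorem10:
  fixes C zrw zro zwo :: nat
  assumes "zrw + zro + zwo \<le> C"
  shows "capacity C zrw zro zwo = max 0 (real C - real zro - real zwo - real zrw)"
proof -
  define D where "D = C - (zrw + zro + zwo)"
  let ?S = "{R. achievable C zrw zro zwo R}"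
  have upper: "R \<le> real D" if "R \<in> ?S" for R
    using achievable_upper_bound[OF assms] that by (simp add: D_def)
  have lower: "R \<in> ?S" if R: "R < real D" for R
  proof (cases "zrw + zro + zwo < C")
    case True
    then show ?thesis using R achievable_lower_bound by (simp add: D_def)
  next
    case False
    then have "D = 0" by (simp add: D_def)
    then show ?thesis using R achievable_nonpos by simp
  qed
  have "Sup ?S = real D"
  proof (rule antisym)
    \<comment> \<open>\<open>cSup_least\<close> needs a nonempty set; this rate is a member even for
      \<open>D = 0\<close>, where it is negative.\<close>
    have "real D - 1 \<in> ?S" by (rule lower) simp
    then show "Sup ?S \<le> real D" using upper by (intro cSup_least) blast+
    have "bdd_above ?S" using upper by (rule bdd_aboveI)
    then have "R \<le> Sup ?S" if "R < real D" for R
      using lower[OF that] by (intro cSup_upper)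
    \<comment> \<open>The supremum is approached from below, so achievability of the rate
      \<open>D\<close> itself is left open.\<close>
    then show "real D \<le> Sup ?S" by (rule dense_le)
  qed
  moreover have "real D = real C - real zro - real zwo - real zrw"
    using assms by (simp add: D_def of_nat_diff)
  moreover have "real D \<ge> 0" by simp
  ultimately show ?thesis
    unfolding capacity_def by linarith
qed

end
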